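(* Let $m\ge2$, let $H$ be a complex Hilbert space, let $E$ be a POVM on $\Omega_m=\{0,\dots,m-1\}^{\mathbb N}$ with values in $B(H)$, and let $X=\{X_w\}$ be a strictly positive normalized range martingale for $E$. Let $E^X$ be the POVM with cylinder values $E^X_w=E_w^{1/2}X_wE_w^{1/2}$. In the factor space coordinates $S^X_w=X_w^{1/2}E_w^{1/2}:H\to H_w$, the edge contractions $C^X_{wj}:H_w\to H_{wj}$ of $E^X$ are $$C^X_{wj}=X_{wj}^{1/2}C_{wj}X_w^{-1/2}$$ for every finite word $w$ and $0\le j\le m-1$. Consequently, the splitting operators of $E^X$ in these coordinates are $$A_w^{X,(j)}=X_w^{-1/2}C_{wj}^*X_{wj}C_{wj}X_w^{-1/2}.$$
   Context: $\Omega_m$ carries its product Borel $\sigma$-algebra $\mathcal B(\Omega_m)$. For a finite word $w=w_1\cdots w_n$ in $\{0,\dots,m-1\}$, $[w]=\{x\in\Omega_m:x_1=w_1,\dots,x_n=w_n\}$; the empty word is $\varnothing$, and $[\varnothing]=\Omega_m$; $wj$ is $w$ with the letter $j$ appended. A POVM on $\Omega_m$ with values in $B(H)$ is a map $E:\mathcal B(\Omega_m)\to B(H)_+$ that is countably additive in the weak operator topology and satisfies $E(\Omega_m)=I$. Put $E_w=E([w])$ and $H_w=\overline{\operatorname{ran}}(E_w^{1/2})$; operators on $H_w$ are extended by zero on $H_w^\perp$ in products inside $B(H)$. The edge contraction $C_{wj}:H_w\to H_{wj}$ of $E$ is the unique contraction with $C_{wj}E_w^{1/2}h=E_{wj}^{1/2}h$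 for all $h\in H$, and the splitting operators of $E$ are the unique positive contractions $A_w^{(j)}\in B(H_w)$ with $E_{wj}=E_w^{1/2}A_w^{(j)}E_w^{1/2}$; one has $A_w^{(j)}=C_{wj}^*C_{wj}$. A bounded range martingale for $E$ is a family of self-adjoint operators $X_w\in B(H_w)$, indexed by all finite words $w$, such that $\sup_w\|X_w\|<\infty$ and $X_w=\sum_{j=0}^{m-1}C_{wj}^*X_{wj}C_{wj}$ for every $w$. It is strictly positive if there are constants $0<a\le b<\infty$ with $aI_{H_w}\le X_w\le bI_{H_w}$ for every $w$, and normalized if $X_\varnothing=I_H$. For a strictly positive normalized $X$, there is a unique POVM $E^X$ on $\Omega_m$ with $E^X([w])=E^X_w:=E_w^{1/2}X_wE_w^{1/2}$ for all $w$. Factor space coordinates: $E^X_w=(S^X_w)^*S^X_w$ and $\operatorname{ran}S^X_w$ is dense in $H_w$, so there is a unique unitary $U^X_w:\overline{\operatorname{ran}}((E^X_w)^{1/2})\to H_w$ with $U^X_w(E^X_w)^{1/2}h=S^X_wh$ for $h\in H$. The edge contractions and splitting operators of $E^X$ "in the factor space coordinates" are the edge contractions and splitting operators of $E^X$ transported to the spaces $H_w$ by these unitaries. Equivalently, $C^X_{wj}:H_w\to H_{wj}$ is the unique contraction with $C^X_{wj}S^X_wh=S^X_{wj}h$ for all $h\in H$, and $A_w^{X,(j)}\in B(H_w)$ is the unique positive contraction with $E^X_{wj}=(S^X_w)^*A_w^{X,(j)}S^X_w$, so $A_w^{X,(j)}=(C^X_{wj})^*C^X_{wj}$. *)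

theory Defs
  imports "HOL-Analysis.Analysis"
begin

(* Complex Hilbert spaces, of arbitrary dimension. The inner product is linear in the
   first argument; the norm is the one of the underlying real inner product space. *)
class chilbert_space = real_inner + complete_space +
  fixes scaleC :: "complex \<Rightarrow> 'a \<Rightarrow> 'a"
    and cinner :: "'a \<Rightarrow> 'a \<Rightarrow> complex"
  assumes scaleC_add_right: "scaleC c (x + y) = scaleC c x + scaleC c y"
    and scaleC_add_left: "scaleC (c + d) x = scaleC c x + scaleC d x"
    and scaleC_scaleC: "scaleC c (scaleC d x) = scaleC (c * d) x"
    and scaleC_of_real: "scaleC (complex_of_real r) x = r *\<^sub>R x"
    and cinner_add_left: "cinner (x + y) z = cinner x z + cinner y z"
    and cinner_scaleC_left: "cinner (scaleC c x) y = c * cinner x y"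
    and cinner_commute: "cinner y x = cnj (cinner x y)"
    and inner_eq_Re_cinner: "inner x y = Re (cinner x y)"

definition ccomplement :: "'h::chilbert_space set \<Rightarrow> 'h set" where
  "ccomplement V = {x. \<forall>v\<in>V. cinner x v = 0}"

(* The library's bounded operators are only real-linear; B(H) consists of those satisfying
   the following predicate. *)
definition clinear_op :: "('h::chilbert_space \<Rightarrow>\<^sub>L 'h) \<Rightarrow> bool" where
  "clinear_op T \<longleftrightarrow> (\<forall>c x. T (scaleC c x) = scaleC c (T x))"

(* B(V, W) for closed subspaces V, W of H. An operator V -> W is identified with its extension
   by zero on the orthogonal complement of V, so that products and adjoints of
   operators between subspaces are products and adjoints in B(H). *)
definition ops :: "'h::chilbert_space set \<Rightarrow> 'h set \<Rightarrow> ('h \<Rightarrow>\<^sub>L 'h) set" where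
  "ops V W = {T. clinear_op T \<and> (\<forall>x\<in>ccomplement V. T x = 0) \<and> (\<forall>x. T x \<in> W)}"

definition cadj :: "('h::chilbert_space \<Rightarrow>\<^sub>L 'h) \<Rightarrow> ('h \<Rightarrow>\<^sub>L 'h)" where
  "cadj T = (THE S :: 'h \<Rightarrow>\<^sub>L 'h. \<forall>x y. cinner (T x) y = cinner x (S y))"

definition positive_op :: "('h::chilbert_space \<Rightarrow>\<^sub>L 'h) \<Rightarrow> bool" where
  "positive_op T \<longleftrightarrow> clinear_op T \<and> (\<forall>x. cinner (T x) x \<in> \<real>\<^sub>\<ge>\<^sub>0)"

(* The order S <= T between the compressions to V. For T = id_blinfun the compression
   is the identity of V. *)
definition op_le_on :: "'h::chilbert_space set \<Rightarrow> ('h \<Rightarrow>\<^sub>L 'h) \<Rightarrow> ('h \<Rightarrow>\<^sub>L 'h) \<Rightarrow> bool" where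
  "op_le_on V S T \<longleftrightarrow> (\<forall>v\<in>V. cinner ((T - S) v) v \<in> \<real>\<^sub>\<ge>\<^sub>0)"

(* Positive square root and inverse in the algebra B(V). *)
definition op_sqrt :: "'h::chilbert_space set \<Rightarrow> ('h \<Rightarrow>\<^sub>L 'h) \<Rightarrow> ('h \<Rightarrow>\<^sub>L 'h)" where
  "op_sqrt V T = (THE R. R \<in> ops V V \<and> positive_op R \<and> R o\<^sub>L R = T)"

definition op_inv :: "'h::chilbert_space set \<Rightarrow> ('h \<Rightarrow>\<^sub>L 'h) \<Rightarrow> ('h \<Rightarrow>\<^sub>L 'h)" where
  "op_inv V T = (THE R. R \<in> ops V V \<and> (\<forall>v\<in>V. R (T v) = v \<and> T (R v) = v))"

(* Sequences over {0..<m}, indexed from 0 instead of 1. *)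
definition Omega :: "nat \<Rightarrow> (nat \<Rightarrow> nat) measure" where
  "Omega m = PiM UNIV (\<lambda>_. count_space {..<m})"

definition words :: "nat \<Rightarrow> nat list set" where
  "words m = lists {..<m}"

definition cyl :: "nat \<Rightarrow> nat list \<Rightarrow> (nat \<Rightarrow> nat) set" where
  "cyl m w = {x \<in> space (Omega m). \<forall>i<length w. x i = w ! i}"

(* Only the values on measurable sets are relevant. *)
definition povm :: "nat \<Rightarrow> ((nat \<Rightarrow> nat) set \<Rightarrow> ('h::chilbert_space \<Rightarrow>\<^sub>L 'h)) \<Rightarrow> bool" where
  "povm m E \<longleftrightarrow>
     (\<forall>B\<in>sets (Omega m). positive_op (E B)) \<and>
     (\<forall>F. range F \<subseteq> sets (Omega m) \<and> disjoint_family F \<longrightarrow>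
        (\<forall>x y. (\<lambda>n::nat. cinner (E (F n) x) y) sums cinner (E (\<Union>n. F n) x) y)) \<and>
     E (space (Omega m)) = id_blinfun"

context
  fixes m :: nat and E :: "(nat \<Rightarrow> nat) set \<Rightarrow> ('h::chilbert_space \<Rightarrow>\<^sub>L 'h)"
begin

definition povm_root :: "nat list \<Rightarrow> ('h \<Rightarrow>\<^sub>L 'h)" where
  "povm_root w = op_sqrt UNIV (E (cyl m w))"

definition range_space :: "nat list \<Rightarrow> 'h set" where
  "range_space w = closure (range (povm_root w))"

definition edge_contraction :: "nat list \<Rightarrow> nat \<Rightarrow> ('h \<Rightarrow>\<^sub>L 'h)" where
  "edge_contraction w j =
     (THE C. C \<in> ops (range_space w) (range_space (w @ [j])) \<and> norm C \<le> 1 \<and>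
        (\<forall>h. C (povm_root w h) = povm_root (w @ [j]) h))"

definition splitting_op :: "nat list \<Rightarrow> nat \<Rightarrow> ('h \<Rightarrow>\<^sub>L 'h)" where
  "splitting_op w j =
     (THE A. A \<in> ops (range_space w) (range_space w) \<and> positive_op A \<and> norm A \<le> 1 \<and>
        E (cyl m (w @ [j])) = povm_root w o\<^sub>L A o\<^sub>L povm_root w)"

definition range_martingale :: "(nat list \<Rightarrow> ('h \<Rightarrow>\<^sub>L 'h)) \<Rightarrow> bool" where
  "range_martingale X \<longleftrightarrow>
     (\<forall>w\<in>words m. X w \<in> ops (range_space w) (range_space w) \<and> cadj (X w) = X w) \<and>
     bdd_above ((\<lambda>w. norm (X w)) ` words m) \<and>
     (\<forall>w\<in>words m. X w =
        (\<Sum>j<m. cadj (edge_contraction w j) o\<^sub>L X (w @ [j]) o\<^sub>L edge_contraction w j))"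

definition strictly_positive :: "(nat list \<Rightarrow> ('h \<Rightarrow>\<^sub>L 'h)) \<Rightarrow> bool" where
  "strictly_positive X \<longleftrightarrow>
     (\<exists>a b::real. 0 < a \<and> a \<le> b \<and>
        (\<forall>w\<in>words m. op_le_on (range_space w) (a *\<^sub>R id_blinfun) (X w) \<and>
                     op_le_on (range_space w) (X w) (b *\<^sub>R id_blinfun)))"

definition normalized :: "(nat list \<Rightarrow> ('h \<Rightarrow>\<^sub>L 'h)) \<Rightarrow> bool" where
  "normalized X \<longleftrightarrow> X [] = id_blinfun"

definition X_root :: "(nat list \<Rightarrow> ('h \<Rightarrow>\<^sub>L 'h)) \<Rightarrow> nat list \<Rightarrow> ('h \<Rightarrow>\<^sub>L 'h)" where
  "X_root X w = op_sqrt (range_space w) (X w)"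

definition X_inv_root :: "(nat list \<Rightarrow> ('h \<Rightarrow>\<^sub>L 'h)) \<Rightarrow> nat list \<Rightarrow> ('h \<Rightarrow>\<^sub>L 'h)" where
  "X_inv_root X w = op_inv (range_space w) (X_root X w)"

definition factor_map :: "(nat list \<Rightarrow> ('h \<Rightarrow>\<^sub>L 'h)) \<Rightarrow> nat list \<Rightarrow> ('h \<Rightarrow>\<^sub>L 'h)" where
  "factor_map X w = X_root X w o\<^sub>L povm_root w"

end

definition unitary_between ::
    "'h::chilbert_space set \<Rightarrow> 'h set \<Rightarrow> ('h \<Rightarrow>\<^sub>L 'h) \<Rightarrow> bool" where
  "unitary_between V W U \<longleftrightarrow>
     U \<in> ops V W \<and> (\<forall>x\<in>V. \<forall>y\<in>V. cinner (U x) (U y) = cinner x y) \<and> U ` V = W"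

(* In the following, F plays the role of the transformed POVM with cylinder values
   S* S for S = factor_map m E X w. *)
context
  fixes m :: nat and E :: "(nat \<Rightarrow> nat) set \<Rightarrow> ('h::chilbert_space \<Rightarrow>\<^sub>L 'h)"
    and X :: "nat list \<Rightarrow> ('h \<Rightarrow>\<^sub>L 'h)" and F :: "(nat \<Rightarrow> nat) set \<Rightarrow> ('h \<Rightarrow>\<^sub>L 'h)"
begin

definition factor_unitary :: "nat list \<Rightarrow> ('h \<Rightarrow>\<^sub>L 'h)" where
  "factor_unitary w =
     (THE U. unitary_between (range_space m F w) (range_space m E w) U \<and>
        (\<forall>h. U (povm_root m F w h) = factor_map m E X w h))"

definition coord_edge_contraction :: "nat list \<Rightarrow> nat \<Rightarrow> ('h \<Rightarrow>\<^sub>L 'h)" where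
  "coord_edge_contraction w j =
     factor_unitary (w @ [j]) o\<^sub>L edge_contraction m F w j o\<^sub>L cadj (factor_unitary w)"

definition coord_splitting_op :: "nat list \<Rightarrow> nat \<Rightarrow> ('h \<Rightarrow>\<^sub>L 'h)" where
  "coord_splitting_op w j =
     factor_unitary w o\<^sub>L splitting_op m F w j o\<^sub>L cadj (factor_unitary w)"

end

end

theory Submission
  imports Defs
begin

text \<open>
  Write \<open>R\<close>, \<open>R'\<close> for the roots of \<open>E\<close> at the words \<open>w\<close>, \<open>wj\<close>, \<open>C\<close> for the edge contraction
  with \<open>C R = R'\<close>, and \<open>S = X\<^sub>w^(1/2) R\<close>, \<open>S' = X\<^sub>w\<^sub>j^(1/2) R'\<close> for the factor maps.  The edge
  contraction of the transformed measure, carried over to the factor space coordinates, is the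
  operator that maps \<open>S h\<close> to \<open>S' h\<close> for all \<open>h\<close> and vanishes on the complement of the range space.
  Since \<open>X\<^sub>w^(-1/2) S h = R h\<close>, the operator \<open>X\<^sub>w\<^sub>j^(1/2) C X\<^sub>w^(-1/2)\<close> does the same, and
  \<open>S\<close> has dense range in the range space, so the two agree.  The formula for the splitting operators
  follows because every splitting operator is the product of the adjoint of the edge contraction with
  the edge contraction (\<open>splitting_op_eq\<close>), a relation that the coordinate unitaries preserve.

  The substance is that all the objects, given by definite descriptions, exist and are unique.  This
  needs four facts on an arbitrary complex Hilbert space.  Adjoints come from orthogonal projections
  and the Riesz representation (\<open>ex_adjoint\<close>).  A positive operator has a unique positive square
  root (\<open>ex1_positive_sqrt\<close>), obtained from the norm limit of a quadratic iteration.  A symmetric operator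
  that is bounded below on a closed subspace is invertible there (\<open>op_inv_ops\<close>).  Finally,
  \<open>norm (B h) \<le> norm (A h)\<close> for all \<open>h\<close> gives a contraction \<open>D\<close> with \<open>B = D A\<close>
  (\<open>ex_contraction_factor\<close>), which is unitary between the closed ranges if equality holds
  (\<open>ex_unitary_factor\<close>).  Complex statements are mostly checked in the real inner product, where for
  complex-linear operators the same adjoint relations hold.
\<close>

section \<open>Complex inner products and orthogonal projections\<close>

text \<open>Makes the bounded operators on a Hilbert space a Banach space.\<close>

instance chilbert_space \<subseteq> banach ..

lemma cinner_add_right:
  fixes x :: "'h::chilbert_space"
  shows "cinner x (y + z) = cinner x y + cinner x z"
  by (metis cinner_add_left cinner_commute complex_cnj_add)

lemma cinner_scaleC_right:
  fixes x :: "'h::chilbert_space"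
  shows "cinner x (scaleC c y) = cnj c * cinner x y"
  by (metis cinner_commute cinner_scaleC_left complex_cnj_mult)

lemma Im_cinner:
  fixes x :: "'h::chilbert_space"
  shows "Im (cinner x y) = - inner (scaleC \<i> x) y"
  by (simp add: inner_eq_Re_cinner cinner_scaleC_left)

text \<open>A complex inner product is determined by its real part along all complex multiples of the
  first argument.  This reduces identities for complex-linear operators to the real inner
  product.\<close>

lemma cinner_eqI:
  fixes x y x' y' :: "'h::chilbert_space"
  assumes "\<And>c. inner (scaleC c x) y = inner (scaleC c x') y'"
  shows "cinner x y = cinner x' y'"
proof (rule complex_eqI)
  show "Re (cinner x y) = Re (cinner x' y')"
    using assms[of "complex_of_real 1"] by (simp only: scaleC_of_real inner_eq_Re_cinner) simp
  show "Im (cinner x y) = Im (cinner x' y')"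
    using assms[of \<i>] by (simp add: Im_cinner)
qed

lemma inner_scaleC_left:
  fixes x :: "'h::chilbert_space"
  shows "inner (scaleC c x) y = inner x (scaleC (cnj c) y)"
  by (simp add: inner_eq_Re_cinner cinner_scaleC_left cinner_scaleC_right)

lemma norm_scaleC:
  fixes x :: "'h::chilbert_space"
  shows "norm (scaleC c x) = cmod c * norm x"
proof -
  have "inner (scaleC c x) (scaleC c x) = inner x (scaleC (complex_of_real ((cmod c)\<^sup>2)) x)"
    by (simp only: inner_scaleC_left scaleC_scaleC complex_norm_square mult.commute)
  also have "\<dots> = (cmod c * norm x)\<^sup>2"
    by (simp only: scaleC_of_real inner_scaleR_right power2_norm_eq_inner power_mult_distrib)
  finally show ?thesis
    by (metis abs_mult abs_norm_cancel norm_eq_sqrt_inner real_sqrt_abs)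
qed

lemma bounded_linear_scaleC: "bounded_linear (scaleC c :: 'h::chilbert_space \<Rightarrow> 'h)"
proof (rule bounded_linear_intro[where K = "cmod c"])
  fix x y :: 'h and r :: real
  show "scaleC c (r *\<^sub>R x) = r *\<^sub>R scaleC c x"
    by (metis scaleC_of_real scaleC_scaleC mult.commute)
qed (simp_all add: scaleC_add_right norm_scaleC)

lemma scaleC_diff_right:
  fixes x :: "'h::chilbert_space"
  shows "scaleC c (x - y) = scaleC c x - scaleC c y"
  by (rule linear_diff[OF bounded_linear.linear[OF bounded_linear_scaleC]])

lemma scaleC_zero_right: "scaleC c (0 :: 'h::chilbert_space) = 0"
  by (rule linear_0[OF bounded_linear.linear[OF bounded_linear_scaleC]])

lemma scaleR_scaleC:
  fixes x :: "'h::chilbert_space"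
  shows "r *\<^sub>R scaleC c x = scaleC c (r *\<^sub>R x)"
  by (simp add: scaleC_of_real[symmetric] scaleC_scaleC mult.commute)

text \<open>The closed complex-linear subspaces of a Hilbert space.\<close>

definition closed_csubspace :: "'h::chilbert_space set \<Rightarrow> bool" where
  "closed_csubspace V \<longleftrightarrow> subspace V \<and> closed V \<and> (\<forall>c. \<forall>x\<in>V. scaleC c x \<in> V)"

lemma closed_csubspace_UNIV: "closed_csubspace (UNIV :: 'h::chilbert_space set)"
  by (simp add: closed_csubspace_def)

lemma ccomplement_iff_inner:
  assumes "\<And>c x. x \<in> V \<Longrightarrow> scaleC c x \<in> V"
  shows "u \<in> ccomplement V \<longleftrightarrow> (\<forall>v\<in>V. inner u v = 0)"
proof
  assume "u \<in> ccomplement V"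
  then show "\<forall>v\<in>V. inner u v = 0"
    by (simp add: ccomplement_def inner_eq_Re_cinner)
next
  assume *: "\<forall>v\<in>V. inner u v = 0"
  show "u \<in> ccomplement V"
    unfolding ccomplement_def
  proof (intro CollectI ballI)
    fix v assume "v \<in> V"
    then have "cinner u v = cinner 0 v"
      using * assms by (intro cinner_eqI) (simp add: inner_scaleC_left)
    also have "\<dots> = 0"
      using cinner_add_left[of 0 0 v] by simp
    finally show "cinner u v = 0" .
  qed
qed

lemma ccomplement_inner:
  assumes "closed_csubspace V"
  shows "u \<in> ccomplement V \<longleftrightarrow> (\<forall>v\<in>V. inner u v = 0)"
  using assms by (intro ccomplement_iff_inner) (auto simp: closed_csubspace_def)

lemma ex_nearest_point:
  fixes V :: "'h::chilbert_space set"
  assumes "subspace V" "closed V"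
  shows "\<exists>v\<in>V. \<forall>w\<in>V. norm (x - v) \<le> norm (x - w)"
proof -
  define d where "d = (INF v\<in>V. (norm (x - v))\<^sup>2)"
  have ne: "V \<noteq> {}"
    using subspace_0[OF assms(1)] by auto
  have bdd: "bdd_below ((\<lambda>v. (norm (x - v))\<^sup>2) ` V)"
    by (rule bdd_belowI[of _ 0]) auto
  have d_le: "d \<le> (norm (x - v))\<^sup>2" if "v \<in> V" for v
    unfolding d_def using bdd that by (rule cINF_lower)
  \<comment> \<open>By the parallelogram law, the sets of almost nearest points shrink to a single point.\<close>
  define S where "S n = {v\<in>V. (norm (x - v))\<^sup>2 \<le> d + 1 / real (Suc n)}" for n
  have "closed (S n)" for n
    unfolding S_def
    using closed_Collect_le[of "\<lambda>v. (norm (x - v))\<^sup>2" "\<lambda>v. d + 1 / real (Suc n)"]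
      assms(2) closed_Int by (force simp: Collect_conj_eq intro!: continuous_intros)
  moreover have "S n \<noteq> {}" for n
  proof -
    have "(INF v\<in>V. (norm (x - v))\<^sup>2) < d + 1 / real (Suc n)"
      by (simp add: d_def)
    then show ?thesis
      using cINF_less_iff[OF ne bdd] unfolding S_def by (force intro: less_imp_le)
  qed
  moreover have "S n \<subseteq> S k" if "k \<le> n" for k n
  proof -
    have "1 / real (Suc n) \<le> 1 / real (Suc k)"
      using that by (intro divide_left_mono) auto
    then show ?thesis
      by (auto simp: S_def)
  qed
  moreover have "\<exists>n. \<forall>u\<in>S n. \<forall>v\<in>S n. dist u v < e" if "e > 0" for e
  proof -
    obtain n where n: "4 / e\<^sup>2 < real (Suc n)"
      by (metis reals_Archimedean2 less_trans of_nat_less_iff lessI)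
    have "dist u v < e" if "u \<in> S n" "v \<in> S n" for u v
    proof -
      have "(1/2) *\<^sub>R (u + v) \<in> V"
        using that assms(1) by (auto simp: S_def intro: subspace_scale subspace_add)
      then have "4 * d \<le> 4 * (norm (x - (1/2) *\<^sub>R (u + v)))\<^sup>2"
        using d_le by simp
      also have "\<dots> = 2 * (norm (x - u))\<^sup>2 + 2 * (norm (x - v))\<^sup>2 - (norm (u - v))\<^sup>2"
        by (simp add: power2_norm_eq_inner inner_diff_left inner_diff_right inner_add_left
            inner_add_right inner_commute algebra_simps)
      finally have "(norm (u - v))\<^sup>2 \<le> 4 / real (Suc n)"
        using that by (simp add: S_def)
      also have "\<dots> < e\<^sup>2"
        using n \<open>e > 0\<close> by (simp add: field_simps)
      finally show ?thesis
        using \<open>e > 0\<close> by (simp add: dist_norm power_less_imp_less_base)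
    qed
    then show ?thesis by blast
  qed
  ultimately obtain v where v: "\<And>n. v \<in> S n"
    using decreasing_closed_nest[of S] by metis
  have "(\<lambda>n. d + 1 / real (Suc n)) \<longlonglongrightarrow> d + 0"
    by (intro tendsto_intros LIMSEQ_Suc[OF lim_1_over_n])
  then have "(norm (x - v))\<^sup>2 \<le> d"
    using v by (intro LIMSEQ_le_const[of _ d]) (auto simp: S_def)
  then have "\<forall>w\<in>V. norm (x - v) \<le> norm (x - w)"
    using d_le by (meson norm_ge_zero order_trans power2_le_imp_le)
  then show ?thesis
    using v[of 0] by (auto simp: S_def)
qed

lemma ex_orthogonal_projection:
  fixes V :: "'h::chilbert_space set"
  assumes "subspace V" "closed V"
  shows "\<exists>v\<in>V. \<forall>w\<in>V. inner (x - v) w = 0"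
proof -
  obtain v where v: "v \<in> V" "\<And>w. w \<in> V \<Longrightarrow> norm (x - v) \<le> norm (x - w)"
    using ex_nearest_point[OF assms] by blast
  have "inner (x - v) w = 0" if w: "w \<in> V" for w
  proof (cases "w = 0")
    case False
    \<comment> \<open>Moving from \<open>v\<close> in the direction \<open>w\<close> by the optimal amount gains the square of
      the inner product, which therefore vanishes.\<close>
    define t where "t = inner (x - v) w / inner w w"
    have "v + t *\<^sub>R w \<in> V"
      using v(1) w assms(1) by (simp add: subspace_add subspace_scale)
    then have "(norm (x - v))\<^sup>2 \<le> (norm (x - (v + t *\<^sub>R w)))\<^sup>2"
      using v(2) by (simp add: power_mono)
    also have "\<dots> = (norm (x - v))\<^sup>2 - 2 * t * inner (x - v) w + t * (t * inner w w)"
      by (simp add: power2_norm_eq_inner inner_diff_left inner_diff_right inner_add_left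
            inner_add_right inner_commute algebra_simps)
    also have "t * inner w w = inner (x - v) w"
      using False by (simp add: t_def)
    finally have "(inner (x - v) w)\<^sup>2 / inner w w \<le> 0"
      by (simp add: t_def power2_eq_square)
    moreover have "0 < inner w w"
      using False by simp
    ultimately have "(inner (x - v) w)\<^sup>2 \<le> 0"
      by (metis divide_pos_pos not_less)
    then show ?thesis by simp
  qed simp
  then show ?thesis
    using v(1) by blast
qed

lemma ex_ccomplement_decomposition:
  assumes "closed_csubspace V"
  shows "\<exists>v\<in>V. x - v \<in> ccomplement V"
  using ex_orthogonal_projection[of V x] assms ccomplement_inner[OF assms]
  by (auto simp: closed_csubspace_def)

lemma subspace_ccomplement:
  assumes "closed_csubspace V"
  shows "subspace (ccomplement V)"
  by (auto simp: subspace_def ccomplement_inner[OF assms] inner_add_left)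

lemma scaleC_ccomplement: "u \<in> ccomplement V \<Longrightarrow> scaleC c u \<in> ccomplement V"
  by (auto simp: ccomplement_def cinner_scaleC_left)

text \<open>\<open>V\<close> contains its double orthogonal complement.\<close>

lemma ccomplement_ccomplement:
  assumes V: "closed_csubspace V" and "\<And>u. u \<in> ccomplement V \<Longrightarrow> inner x u = 0"
  shows "x \<in> V"
proof -
  obtain v where v: "v \<in> V" "x - v \<in> ccomplement V"
    using ex_ccomplement_decomposition[OF V] by blast
  then have "inner (x - v) (x - v) = 0"
    using assms(2)[OF v(2)] by (simp add: inner_diff_left ccomplement_inner[OF V] inner_commute)
  then show ?thesis
    using v(1) by simp
qed

text \<open>The Riesz representation theorem for real-linear functionals.\<close>

lemma ex_riesz_representation:
  fixes f :: "'h::chilbert_space \<Rightarrow> real"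
  assumes "bounded_linear f"
  shows "\<exists>y. \<forall>x. f x = inner x y"
proof (cases "\<forall>x. f x = 0")
  case True
  then show ?thesis by (auto intro: exI[of _ 0])
next
  case False
  then obtain z where z: "f z \<noteq> 0" by blast
  interpret bounded_linear f by fact
  define K where "K = {x. f x = 0}"
  have "subspace K"
    by (auto simp: K_def subspace_def add scaleR zero)
  moreover have "closed K"
    unfolding K_def by (intro closed_Collect_eq continuous_intros continuous_on assms)
  ultimately obtain v where v: "v \<in> K" "\<forall>w\<in>K. inner (z - v) w = 0"
    using ex_orthogonal_projection by blast
  define u where "u = z - v"
  have fu: "f u \<noteq> 0"
    using v(1) z by (simp add: u_def K_def diff)
  then have u: "u \<noteq> 0"
    using zero by auto
  have "f x = inner x ((f u / inner u u) *\<^sub>R u)" for x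
  proof -
    have "f (x - (f x / f u) *\<^sub>R u) = 0"
      using fu by (simp add: diff scaleR)
    then have "inner u (x - (f x / f u) *\<^sub>R u) = 0"
      using v(2) by (simp add: u_def K_def)
    then have "inner x u = f x / f u * inner u u"
      by (simp add: inner_diff_right inner_commute)
    then show ?thesis
      using fu u by simp
  qed
  then show ?thesis by blast
qed

section \<open>Bounded operators: adjoints, positivity and extensions\<close>

lemma clinear_op_scaleC: "clinear_op T \<Longrightarrow> T (scaleC c x) = scaleC c (T x)"
  by (simp add: clinear_op_def)

lemma clinear_op_compose: "clinear_op S \<Longrightarrow> clinear_op T \<Longrightarrow> clinear_op (S o\<^sub>L T)"
  by (simp add: clinear_op_def)

lemma cinner_adjointI:
  assumes "clinear_op T" "\<And>x y. inner (T x) y = inner x (S y)"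
  shows "cinner (T x) y = cinner x (S y)"
  by (rule cinner_eqI) (metis assms clinear_op_def)

lemma inner_right_eqI:
  fixes y :: "'a::real_inner"
  assumes "\<And>x. inner x y = inner x z"
  shows "y = z"
proof -
  have "inner (y - z) (y - z) = 0"
    using assms[of "y - z"] by (simp only: inner_diff_right)
  then show ?thesis by simp
qed

lemma cinner_right_eqI:
  fixes y :: "'h::chilbert_space"
  assumes "\<And>x. cinner x y = cinner x z"
  shows "y = z"
  by (rule inner_right_eqI) (simp add: assms inner_eq_Re_cinner)

text \<open>For a complex-linear operator it is enough to verify the defining relation of the adjoint
  in the real inner product.\<close>

lemma cadj_eqI:
  fixes S T :: "'h::chilbert_space \<Rightarrow>\<^sub>L 'h"
  assumes "clinear_op T" "\<And>x y. inner (T x) y = inner x (S y)"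
  shows "cadj T = S"
  unfolding cadj_def
proof (rule the_equality)
  show "\<forall>x y. cinner (T x) y = cinner x (S y)"
    using cinner_adjointI assms by blast
next
  fix R :: "'h \<Rightarrow>\<^sub>L 'h"
  assume "\<forall>x y. cinner (T x) y = cinner x (R y)"
  then have "cinner x (R y) = cinner x (S y)" for x y
    using cinner_adjointI[OF assms] by simp
  then show "R = S"
    by (intro blinfun_eqI cinner_right_eqI)
qed

lemma ex_adjoint:
  fixes T :: "'h::chilbert_space \<Rightarrow>\<^sub>L 'h"
  shows "\<exists>S :: 'h \<Rightarrow>\<^sub>L 'h. \<forall>x y. inner (T x) y = inner x (S y)"
proof -
  have "\<exists>z. \<forall>x. inner (T x) y = inner x z" for y
    by (rule ex_riesz_representation)
      (intro bounded_linear_compose[OF bounded_linear_inner_left] blinfun.bounded_linear_right)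
  then obtain g where g: "\<And>x y. inner (T x) y = inner x (g y)"
    by metis
  have "bounded_linear g"
  proof (rule bounded_linear_intro[where K = "norm T"])
    show "g (x + y) = g x + g y" for x y
      by (rule inner_right_eqI) (simp add: g[symmetric] inner_add_right)
    show "g (r *\<^sub>R x) = r *\<^sub>R g x" for r x
      by (rule inner_right_eqI) (simp add: g[symmetric])
    show "norm (g y) \<le> norm y * norm T" for y
    proof (cases "g y = 0")
      case False
      have "norm (g y) * norm (g y) = inner (T (g y)) y"
        by (simp add: g power2_norm_eq_inner[symmetric] power2_eq_square)
      also have "\<dots> \<le> norm (T (g y)) * norm y"
        by (rule norm_cauchy_schwarz)
      also have "\<dots> \<le> norm T * norm (g y) * norm y"
        by (intro mult_right_mono norm_blinfun) auto
      finally show ?thesis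
        using False by (simp add: mult_ac)
    qed simp
  qed
  then show ?thesis
    using g by (auto intro!: exI[of _ "Blinfun g"] simp: bounded_linear_Blinfun_apply)
qed

lemma inner_cadj:
  assumes "clinear_op T"
  shows "inner (T x) y = inner x (cadj T y)"
  using ex_adjoint[of T] cadj_eqI[OF assms] by metis

lemma clinear_op_cadj:
  assumes "clinear_op T"
  shows "clinear_op (cadj T)"
  unfolding clinear_op_def
proof (intro allI)
  fix c x
  have "cinner y (cadj T (scaleC c x)) = cinner y (scaleC c (cadj T x))" for y
    using cinner_adjointI[OF assms inner_cadj[OF assms]] cinner_scaleC_right by metis
  then show "cadj T (scaleC c x) = scaleC c (cadj T x)"
    by (rule cinner_right_eqI)
qed

lemma cadj_compose:
  assumes "clinear_op S" "clinear_op T"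
  shows "cadj (S o\<^sub>L T) = cadj T o\<^sub>L cadj S"
  by (rule cadj_eqI) (simp_all add: assms clinear_op_compose inner_cadj)

lemma cadj_cadj:
  assumes "clinear_op T"
  shows "cadj (cadj T) = T"
proof (rule cadj_eqI[OF clinear_op_cadj[OF assms]])
  show "inner (cadj T x) y = inner x (T y)" for x y
    using inner_cadj[OF assms, of y x] by (simp add: inner_commute)
qed

text \<open>Positivity in terms of the real inner product; the symmetry of \<open>T\<close> comes from
  polarization.\<close>

lemma positive_op_iff:
  "positive_op T \<longleftrightarrow>
     clinear_op T \<and> (\<forall>x y. inner (T x) y = inner x (T y)) \<and> (\<forall>x. 0 \<le> inner (T x) x)"
proof
  assume pos: "positive_op T"
  then have T: "clinear_op T" and r: "\<And>x. cinner (T x) x \<in> \<real>\<^sub>\<ge>\<^sub>0"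
    by (auto simp: positive_op_def)
  have Im: "Im (cinner (T x) y) = Im (cinner x (T y))" for x y
  proof -
    have "Im (cinner (T (x + y)) (x + y)) = 0" "Im (cinner (T x) x) = 0" "Im (cinner (T y) y) = 0"
      using r by (auto simp: complex_nonneg_Reals_iff)
    then have "Im (cinner (T x) y) = - Im (cinner (T y) x)"
      by (simp add: blinfun.add_right cinner_add_left cinner_add_right)
    also have "\<dots> = Im (cinner x (T y))"
      by (subst cinner_commute) simp
    finally show ?thesis .
  qed
  have "inner (T x) y = inner x (T y)" for x y
    using Im[of "scaleC \<i> x" y]
    by (simp add: clinear_op_scaleC[OF T] cinner_scaleC_left inner_eq_Re_cinner)
  moreover have "0 \<le> inner (T x) x" for x
    using r by (simp add: inner_eq_Re_cinner complex_nonneg_Reals_iff)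
  ultimately show "clinear_op T \<and> (\<forall>x y. inner (T x) y = inner x (T y)) \<and> (\<forall>x. 0 \<le> inner (T x) x)"
    using T by blast
next
  assume *: "clinear_op T \<and> (\<forall>x y. inner (T x) y = inner x (T y)) \<and> (\<forall>x. 0 \<le> inner (T x) x)"
  then have "cinner (T x) x = cnj (cinner (T x) x)" for x
    using cinner_adjointI[of T T] cinner_commute by metis
  then have "Im (cinner (T x) x) = 0" for x
    by (metis Im_complex_of_real Reals_cnj_iff complex_is_Real_iff)
  moreover have "0 \<le> Re (cinner (T x) x)" for x
    using * by (metis inner_eq_Re_cinner)
  ultimately show "positive_op T"
    using * by (simp add: positive_op_def complex_nonneg_Reals_iff)
qed

lemma positive_opD:
  assumes "positive_op T"
  shows "clinear_op T" "inner (T x) y = inner x (T y)" "0 \<le> inner (T x) x"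
  using assms by (auto simp: positive_op_iff)

lemma positive_op_cadj_compose:
  assumes "clinear_op T"
  shows "positive_op (cadj T o\<^sub>L T)"
proof -
  have eq: "inner (cadj T (T x)) y = inner (T x) (T y)" for x y
    by (simp add: inner_commute[of _ y] inner_cadj[OF assms, symmetric] inner_commute[of "T y"])
  then show ?thesis
    using assms
    by (simp add: positive_op_iff clinear_op_compose clinear_op_cadj inner_cadj[OF assms, symmetric])
qed

text \<open>The Cauchy--Schwarz inequality for the form of a positive operator.\<close>

lemma positive_op_Cauchy_Schwarz:
  assumes "positive_op T"
  shows "(inner (T x) y)\<^sup>2 \<le> inner (T x) x * inner (T y) y"
proof -
  note T = positive_opD[OF assms]
  define a b c where "a = inner (T x) x" and "b = inner (T x) y" and "c = inner (T y) y"
  have b': "inner (T y) x = b"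
    by (metis T(2) b_def inner_commute)
  have q: "0 \<le> s * s * a + 2 * s * t * b + t * t * c" for s t
    using T(3)[of "s *\<^sub>R x + t *\<^sub>R y"] b'
    by (simp add: blinfun.bilinear_simps inner_add_left inner_add_right a_def b_def c_def
        algebra_simps)
  have "0 \<le> a * (a * c - b\<^sup>2)" "0 \<le> c * (a * c - b\<^sup>2)"
    using q[of b "- a"] q[of c "- b"] by (simp_all add: power2_eq_square algebra_simps)
  moreover have "b = 0" if "a = 0" "c = 0"
    using q[of 1 1] q[of 1 "-1"] that by simp
  moreover have "0 \<le> a" "0 \<le> c"
    using T(3) by (auto simp: a_def c_def)
  ultimately show ?thesis
    unfolding a_def[symmetric] b_def[symmetric] c_def[symmetric]
    by (cases "a = 0"; cases "c = 0") (auto simp: zero_le_mult_iff mult_le_0_iff)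
qed

lemma positive_op_eq_0:
  assumes "positive_op T" "inner (T x) x = 0"
  shows "T x = 0"
  using positive_op_Cauchy_Schwarz[OF assms(1), of x "T x"] assms(2) by simp

lemma norm_positive_op_le_1:
  assumes "positive_op T" "\<And>x. inner (T x) x \<le> (norm x)\<^sup>2"
  shows "norm T \<le> 1"
proof (rule norm_blinfun_bound)
  fix x
  have "(norm (T x))\<^sup>2 * (norm (T x))\<^sup>2 \<le> inner (T x) x * inner (T (T x)) (T x)"
    using positive_op_Cauchy_Schwarz[OF assms(1), of x "T x"]
    by (simp add: power2_norm_eq_inner) (simp add: power2_eq_square)
  also have "\<dots> \<le> (norm x)\<^sup>2 * (norm (T x))\<^sup>2"
    by (intro mult_mono assms(2) positive_opD(3)[OF assms(1)]) simp
  finally have "T x \<noteq> 0 \<Longrightarrow> (norm (T x))\<^sup>2 \<le> (norm x)\<^sup>2"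
    by (rule mult_right_le_imp_le) simp
  then show "norm (T x) \<le> 1 * norm x"
    by (cases "T x = 0") (auto intro: power2_le_imp_le)
qed simp

section \<open>Square roots of positive operators\<close>

text \<open>The iteration \<open>Y \<mapsto> (A + Y\<^sup>2) / 2\<close> from \<open>0\<close>.  For \<open>norm A \<le> 1\<close> it converges in norm to
  some \<open>Y\<close> with \<open>(1 - Y)\<^sup>2 = 1 - A\<close>.\<close>

primrec sqrt_iter :: "('h::chilbert_space \<Rightarrow>\<^sub>L 'h) \<Rightarrow> nat \<Rightarrow> ('h \<Rightarrow>\<^sub>L 'h)" where
  "sqrt_iter A 0 = 0"
| "sqrt_iter A (Suc n) = (1/2) *\<^sub>R (A + (sqrt_iter A n o\<^sub>L sqrt_iter A n))"

text \<open>The scalar iteration for \<open>A = 1\<close>.  Its increments dominate those of the operator iteration,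
  and it is increasing and bounded by \<open>1\<close>.\<close>

primrec sqrt_iter_bound :: "nat \<Rightarrow> real" where
  "sqrt_iter_bound 0 = 0"
| "sqrt_iter_bound (Suc n) = (1 + (sqrt_iter_bound n)\<^sup>2) / 2"

lemma sqrt_iter_bound_range: "0 \<le> sqrt_iter_bound n" "sqrt_iter_bound n \<le> 1"
proof -
  have "0 \<le> sqrt_iter_bound n \<and> sqrt_iter_bound n \<le> 1"
    by (induction n) (auto intro: power_le_one add_nonneg_nonneg)
  then show "0 \<le> sqrt_iter_bound n" "sqrt_iter_bound n \<le> 1" by auto
qed

lemma incseq_sqrt_iter_bound: "incseq sqrt_iter_bound"
proof (rule incseq_SucI)
  fix n
  have "0 \<le> (1 - sqrt_iter_bound n)\<^sup>2 / 2" by simp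
  then show "sqrt_iter_bound n \<le> sqrt_iter_bound (Suc n)"
    by (simp add: power2_diff)
qed

lemma norm_sqrt_iter:
  assumes "norm A \<le> 1"
  shows "norm (sqrt_iter A n) \<le> sqrt_iter_bound n"
proof (induction n)
  case (Suc n)
  have "norm (A + (sqrt_iter A n o\<^sub>L sqrt_iter A n)) \<le> norm A + norm (sqrt_iter A n o\<^sub>L sqrt_iter A n)"
    by (rule norm_triangle_ineq)
  also have "\<dots> \<le> 1 + norm (sqrt_iter A n) * norm (sqrt_iter A n)"
    by (intro add_mono assms norm_blinfun_compose)
  also have "\<dots> \<le> 1 + sqrt_iter_bound n * sqrt_iter_bound n"
    by (intro add_left_mono mult_mono Suc sqrt_iter_bound_range) simp
  finally show ?case
    by (simp add: power2_eq_square)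
qed simp

lemma norm_sqrt_iter_Suc_diff:
  assumes "norm A \<le> 1"
  shows "norm (sqrt_iter A (Suc n) - sqrt_iter A n) \<le> sqrt_iter_bound (Suc n) - sqrt_iter_bound n"
proof (induction n)
  case 0
  then show ?case using assms by simp
next
  case (Suc n)
  define Y Z where "Y = sqrt_iter A (Suc n)" and "Z = sqrt_iter A n"
  define y z where "y = sqrt_iter_bound (Suc n)" and "z = sqrt_iter_bound n"
  have YZ: "norm (Y - Z) \<le> y - z"
    using Suc.IH by (simp add: Y_def Z_def y_def z_def)
  have Yy: "norm Y \<le> y" and Zz: "norm Z \<le> z"
    using norm_sqrt_iter[OF assms] unfolding Y_def Z_def y_def z_def by blast+
  have y0: "0 \<le> y" "0 \<le> z" "0 \<le> y - z"
    using sqrt_iter_bound_range order_trans[OF norm_ge_zero YZ] unfolding y_def z_def by blast+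
  have "sqrt_iter A (Suc (Suc n)) = (1/2) *\<^sub>R (A + (Y o\<^sub>L Y))"
      "sqrt_iter A (Suc n) = (1/2) *\<^sub>R (A + (Z o\<^sub>L Z))"
    unfolding Y_def Z_def by (rule sqrt_iter.simps(2))+
  then have "sqrt_iter A (Suc (Suc n)) - sqrt_iter A (Suc n)
      = (1/2) *\<^sub>R ((A + (Y o\<^sub>L Y)) - (A + (Z o\<^sub>L Z)))"
    by (simp only: scaleR_diff_right)
  also have "(A + (Y o\<^sub>L Y)) - (A + (Z o\<^sub>L Z)) = (Y o\<^sub>L (Y - Z)) + ((Y - Z) o\<^sub>L Z)"
    by (rule blinfun_eqI) (simp add: blinfun.bilinear_simps)
  finally have "norm (sqrt_iter A (Suc (Suc n)) - sqrt_iter A (Suc n))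
      = norm ((Y o\<^sub>L (Y - Z)) + ((Y - Z) o\<^sub>L Z)) / 2"
    by simp
  also have "\<dots> \<le> (norm (Y o\<^sub>L (Y - Z)) + norm ((Y - Z) o\<^sub>L Z)) / 2"
    by (intro divide_right_mono norm_triangle_ineq) simp
  also have "\<dots> \<le> (norm Y * norm (Y - Z) + norm (Y - Z) * norm Z) / 2"
    by (intro divide_right_mono add_mono norm_blinfun_compose) simp
  also have "\<dots> \<le> (y * (y - z) + (y - z) * z) / 2"
    by (intro divide_right_mono add_mono mult_mono YZ Yy Zz y0) auto
  also have "\<dots> = (1 + y\<^sup>2) / 2 - (1 + z\<^sup>2) / 2"
    by (simp add: power2_eq_square field_simps)
  also have "\<dots> = sqrt_iter_bound (Suc (Suc n)) - sqrt_iter_bound (Suc n)"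
    by (simp add: y_def z_def)
  finally show ?case .
qed

lemma convergent_sqrt_iter:
  fixes A :: "'h::chilbert_space \<Rightarrow>\<^sub>L 'h"
  assumes "norm A \<le> 1"
  shows "convergent (sqrt_iter A)"
proof -
  have le: "norm (sqrt_iter A k - sqrt_iter A n) \<le> sqrt_iter_bound k - sqrt_iter_bound n"
    if "n \<le> k" for n k
    using that
  proof (induction k rule: dec_induct)
    case (step k)
    have "norm (sqrt_iter A (Suc k) - sqrt_iter A n)
        \<le> norm (sqrt_iter A (Suc k) - sqrt_iter A k) + norm (sqrt_iter A k - sqrt_iter A n)"
      using norm_triangle_ineq[of "sqrt_iter A (Suc k) - sqrt_iter A k" "sqrt_iter A k - sqrt_iter A n"]
      by (simp del: sqrt_iter.simps)
    then show ?case
      using norm_sqrt_iter_Suc_diff[OF assms, of k] step.IH by linarith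
  qed simp
  then have dist_le: "dist (sqrt_iter A n) (sqrt_iter A k) \<le> dist (sqrt_iter_bound n) (sqrt_iter_bound k)"
    for n k
    unfolding dist_norm real_norm_def
    using le[of n k] le[of k n] norm_minus_commute[of "sqrt_iter A n" "sqrt_iter A k"]
    by (cases "n \<le> k") linarith+
  have "convergent sqrt_iter_bound"
    using incseq_convergent[OF incseq_sqrt_iter_bound] sqrt_iter_bound_range(2)
    by (metis convergent_def)
  then have "Cauchy sqrt_iter_bound"
    by (rule convergent_Cauchy)
  then have "Cauchy (sqrt_iter A)"
    unfolding Cauchy_def using dist_le by (meson order_le_less_trans)
  then show ?thesis
    by (rule Cauchy_convergent)
qed

lemma ex_sqrt_one_minus:
  fixes A :: "'h::chilbert_space \<Rightarrow>\<^sub>L 'h"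
  assumes A: "norm A \<le> 1" "clinear_op A" "\<And>x y. inner (A x) y = inner x (A y)"
  shows "\<exists>R. positive_op R \<and> R o\<^sub>L R = id_blinfun - A \<and>
     (\<forall>S. S o\<^sub>L A = A o\<^sub>L S \<longrightarrow> S o\<^sub>L R = R o\<^sub>L S)"
proof -
  obtain Y where Y: "sqrt_iter A \<longlonglongrightarrow> Y"
    using convergent_sqrt_iter[OF A(1)] by (auto simp: convergent_def)
  have Y_apply: "(\<lambda>n. sqrt_iter A n x) \<longlonglongrightarrow> Y x" for x
    by (intro blinfun.tendsto Y tendsto_const)
  have "norm Y \<le> 1"
    using Y norm_sqrt_iter[OF A(1)] sqrt_iter_bound_range(2)
    by (intro LIMSEQ_le_const2[OF tendsto_norm]) (auto intro: order_trans)
  have "(\<lambda>n. sqrt_iter A (Suc n)) \<longlonglongrightarrow> (1/2) *\<^sub>R (A + (Y o\<^sub>L Y))"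
    unfolding sqrt_iter.simps
    by (intro tendsto_intros bounded_bilinear.tendsto[OF bounded_bilinear_blinfun_compose] Y)
  then have fixpoint: "Y = (1/2) *\<^sub>R (A + (Y o\<^sub>L Y))"
    using LIMSEQ_Suc[OF Y] by (metis LIMSEQ_unique)
  have sym: "inner (sqrt_iter A n x) y = inner x (sqrt_iter A n y)" for n x y
    by (induction n arbitrary: x y)
      (simp_all add: A(3) blinfun.bilinear_simps inner_add_left inner_add_right)
  have Y_sym: "inner (Y x) y = inner x (Y y)" for x y
  proof (rule LIMSEQ_unique)
    show "(\<lambda>n. inner (sqrt_iter A n x) y) \<longlonglongrightarrow> inner (Y x) y"
      by (intro tendsto_intros Y_apply)
    show "(\<lambda>n. inner (sqrt_iter A n x) y) \<longlonglongrightarrow> inner x (Y y)"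
      unfolding sym by (intro tendsto_intros Y_apply)
  qed
  have clin: "sqrt_iter A n (scaleC c x) = scaleC c (sqrt_iter A n x)" for n c x
    by (induction n arbitrary: x)
      (simp_all add: clinear_op_scaleC[OF A(2)] blinfun.bilinear_simps scaleC_add_right
        scaleR_scaleC[symmetric] scaleC_zero_right)
  have Y_clin: "Y (scaleC c x) = scaleC c (Y x)" for c x
  proof (rule LIMSEQ_unique)
    show "(\<lambda>n. sqrt_iter A n (scaleC c x)) \<longlonglongrightarrow> Y (scaleC c x)"
      by (rule Y_apply)
    show "(\<lambda>n. sqrt_iter A n (scaleC c x)) \<longlonglongrightarrow> scaleC c (Y x)"
      unfolding clin by (rule bounded_linear.tendsto[OF bounded_linear_scaleC Y_apply])
  qed
  define R where "R = id_blinfun - Y"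
  have "positive_op R"
    unfolding positive_op_iff
  proof (intro conjI allI)
    show "clinear_op R"
      unfolding clinear_op_def R_def
      by (simp add: blinfun.bilinear_simps Y_clin scaleC_diff_right)
    show "inner (R x) y = inner x (R y)" for x y
      by (simp add: R_def blinfun.bilinear_simps inner_diff_left inner_diff_right Y_sym)
    fix x
    have "inner (Y x) x \<le> norm (Y x) * norm x"
      by (rule norm_cauchy_schwarz)
    also have "\<dots> \<le> (norm Y * norm x) * norm x"
      by (intro mult_right_mono norm_blinfun) simp
    also have "\<dots> \<le> (1 * norm x) * norm x"
      using \<open>norm Y \<le> 1\<close> by (intro mult_right_mono) auto
    finally show "0 \<le> inner (R x) x"
      by (simp add: R_def blinfun.bilinear_simps inner_diff_left dot_square_norm power2_eq_square)
  qed
  moreover have "R o\<^sub>L R = id_blinfun - A"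
  proof (rule blinfun_eqI)
    fix x
    have "2 *\<^sub>R Y x = 2 *\<^sub>R ((1/2) *\<^sub>R (A + (Y o\<^sub>L Y))) x"
      using fixpoint by simp
    then have "2 *\<^sub>R Y x = A x + Y (Y x)"
      by (simp add: blinfun.bilinear_simps)
    then have "x - Y x - (Y x - Y (Y x)) = x - A x"
      by (simp add: scaleR_2 algebra_simps)
    then show "(R o\<^sub>L R) x = (id_blinfun - A) x"
      by (simp add: R_def blinfun.bilinear_simps)
  qed
  moreover have "S o\<^sub>L R = R o\<^sub>L S" if S: "S o\<^sub>L A = A o\<^sub>L S" for S
  proof (rule blinfun_eqI)
    fix x
    have SA: "S (A x) = A (S x)" for x
      using S by (metis blinfun_apply_blinfun_compose)
    have comm: "S (sqrt_iter A n x) = sqrt_iter A n (S x)" for n x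
      by (induction n arbitrary: x) (simp_all add: SA blinfun.bilinear_simps)
    have "S (Y x) = Y (S x)"
    proof (rule LIMSEQ_unique)
      show "(\<lambda>n. S (sqrt_iter A n x)) \<longlonglongrightarrow> S (Y x)"
        by (intro blinfun.tendsto tendsto_const Y_apply)
      show "(\<lambda>n. S (sqrt_iter A n x)) \<longlonglongrightarrow> Y (S x)"
        unfolding comm by (rule Y_apply)
    qed
    then show "(S o\<^sub>L R) x = (R o\<^sub>L S) x"
      by (simp add: R_def blinfun.bilinear_simps)
  qed
  ultimately show ?thesis by blast
qed

lemma ex_positive_sqrt:
  fixes T :: "'h::chilbert_space \<Rightarrow>\<^sub>L 'h"
  assumes T: "positive_op T"
  shows "\<exists>R. positive_op R \<and> R o\<^sub>L R = T \<and> (\<forall>S. S o\<^sub>L T = T o\<^sub>L S \<longrightarrow> S o\<^sub>L R = R o\<^sub>L S)"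
proof -
  note T' = positive_opD[OF T]
  define c where "c = norm T + 1"
  have c: "c > 0"
    unfolding c_def by (simp add: add_nonneg_pos)
  \<comment> \<open>Rescaled so that \<open>0 \<le> T / c \<le> 1\<close>.\<close>
  define A where "A = id_blinfun - (1/c) *\<^sub>R T"
  have A_clin: "clinear_op A"
    by (simp add: A_def clinear_op_def blinfun.bilinear_simps clinear_op_scaleC[OF T'(1)]
        scaleR_scaleC scaleC_diff_right)
  have A_sym: "inner (A x) y = inner x (A y)" for x y
    by (simp add: A_def blinfun.bilinear_simps inner_diff_left inner_diff_right T'(2))
  have T_le: "inner (T x) x \<le> c * (norm x)\<^sup>2" for x
  proof -
    have "inner (T x) x \<le> norm (T x) * norm x"
      by (rule norm_cauchy_schwarz)
    also have "\<dots> \<le> (norm T * norm x) * norm x"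
      by (intro mult_right_mono norm_blinfun) simp
    also have "\<dots> \<le> c * (norm x)\<^sup>2"
      by (simp add: c_def power2_eq_square algebra_simps)
    finally show ?thesis .
  qed
  have "0 \<le> inner (A x) x" for x
    using T_le[of x] c
    by (simp add: A_def blinfun.bilinear_simps inner_diff_left dot_square_norm field_simps)
  then have "positive_op A"
    unfolding positive_op_iff using A_clin A_sym by blast
  moreover have "inner (A x) x \<le> (norm x)\<^sup>2" for x
    using T'(3)[of x] c
    by (simp add: A_def blinfun.bilinear_simps inner_diff_left dot_square_norm)
  ultimately have "norm A \<le> 1"
    by (rule norm_positive_op_le_1)
  then obtain Q where Q: "positive_op Q" "Q o\<^sub>L Q = id_blinfun - A"
      "\<And>S. S o\<^sub>L A = A o\<^sub>L S \<Longrightarrow> S o\<^sub>L Q = Q o\<^sub>L S"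
    using ex_sqrt_one_minus A_clin A_sym by blast
  define R where "R = sqrt c *\<^sub>R Q"
  note Q' = positive_opD[OF Q(1)]
  have "clinear_op R"
    by (simp add: R_def clinear_op_def blinfun.bilinear_simps clinear_op_scaleC[OF Q'(1)]
        scaleR_scaleC)
  moreover have "inner (R x) y = inner x (R y)" for x y
    by (simp add: R_def blinfun.bilinear_simps Q'(2))
  moreover have "0 \<le> inner (R x) x" for x
    using c Q'(3) by (simp add: R_def blinfun.bilinear_simps)
  ultimately have "positive_op R"
    unfolding positive_op_iff by blast
  moreover have "R o\<^sub>L R = T"
  proof (rule blinfun_eqI)
    fix x
    have "(R o\<^sub>L R) x = c *\<^sub>R (Q o\<^sub>L Q) x"
      using c by (simp add: R_def blinfun.bilinear_simps)
    also have "\<dots> = T x"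
      unfolding Q(2) using c by (simp add: A_def blinfun.bilinear_simps)
    finally show "(R o\<^sub>L R) x = T x" .
  qed
  moreover have "S o\<^sub>L R = R o\<^sub>L S" if "S o\<^sub>L T = T o\<^sub>L S" for S
  proof -
    have "S o\<^sub>L A = A o\<^sub>L S"
      using fun_cong[OF arg_cong[OF that, of blinfun_apply]]
      by (intro blinfun_eqI) (simp add: A_def blinfun.bilinear_simps)
    then have "S o\<^sub>L Q = Q o\<^sub>L S"
      by (rule Q(3))
    then show ?thesis
      by (simp only: R_def bounded_bilinear.scaleR_left[OF bounded_bilinear_blinfun_compose]
          bounded_bilinear.scaleR_right[OF bounded_bilinear_blinfun_compose])
  qed
  ultimately show ?thesis by blast
qed

text \<open>Commuting positive square roots agree: for \<open>y = (R - S) x\<close> one has \<open>(R + S) y = 0\<close>,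
  so that \<open>R y = S y = 0\<close>.\<close>

lemma positive_sqrt_unique:
  fixes R S :: "'h::chilbert_space \<Rightarrow>\<^sub>L 'h"
  assumes R: "positive_op R" and S: "positive_op S" and eq: "R o\<^sub>L R = S o\<^sub>L S"
    and comm: "S o\<^sub>L R = R o\<^sub>L S"
  shows "R = S"
proof (rule blinfun_eqI)
  fix x
  define y where "y = R x - S x"
  have eq': "R (R z) = S (S z)" and comm': "S (R z) = R (S z)" for z
    using eq comm by (metis blinfun_apply_blinfun_compose)+
  have "R y + S y = 0"
    by (simp add: y_def blinfun.bilinear_simps eq' comm')
  then have "inner (R y) y + inner (S y) y = 0"
    by (metis inner_add_left inner_zero_left)
  then have "inner (R y) y = 0" "inner (S y) y = 0"
    using positive_opD(3)[OF R, of y] positive_opD(3)[OF S, of y] by linarith+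
  then have "R y = 0" "S y = 0"
    using positive_op_eq_0 R S by blast+
  then have "inner y y = 0"
    using positive_opD(2)[OF R, of x y] positive_opD(2)[OF S, of x y]
    by (simp add: y_def inner_diff_left)
  then show "R x = S x"
    by (simp add: y_def)
qed

text \<open>Every positive square root of \<open>T\<close> commutes with \<open>T\<close>, hence with the one constructed above.\<close>

lemma ex1_positive_sqrt:
  assumes "positive_op T"
  shows "\<exists>!R. positive_op R \<and> R o\<^sub>L R = T"
proof -
  obtain R where R: "positive_op R" "R o\<^sub>L R = T" "\<And>S. S o\<^sub>L T = T o\<^sub>L S \<Longrightarrow> S o\<^sub>L R = R o\<^sub>L S"
    using ex_positive_sqrt[OF assms] by blast
  have "S = R" if S: "positive_op S" "S o\<^sub>L S = T" for S
  proof -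
    have "S o\<^sub>L T = T o\<^sub>L S"
      by (rule blinfun_eqI) (simp add: S(2)[symmetric])
    then have "R o\<^sub>L S = S o\<^sub>L R"
      by (rule R(3)[symmetric])
    then show ?thesis
      by (rule positive_sqrt_unique[OF S(1) R(1) trans[OF S(2) R(2)[symmetric]]])
  qed
  then show ?thesis
    using R by blast
qed

section \<open>Operators between closed subspaces\<close>

lemma opsD:
  assumes "T \<in> ops V W"
  shows "clinear_op T" "u \<in> ccomplement V \<Longrightarrow> T u = 0" "T x \<in> W"
  using assms by (auto simp: ops_def)

lemma ops_UNIV_iff:
  fixes T :: "'h::chilbert_space \<Rightarrow>\<^sub>L 'h"
  shows "T \<in> ops UNIV UNIV \<longleftrightarrow> clinear_op T"
proof -
  have "u = 0" if "u \<in> ccomplement UNIV" for u :: 'h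
    using that ccomplement_inner[OF closed_csubspace_UNIV, of u] inner_eq_zero_iff by blast
  then have "T u = 0" if "u \<in> ccomplement UNIV" for u
    using that by (metis blinfun.zero_right)
  then show ?thesis
    by (auto simp: ops_def)
qed

lemma ops_compose: "S \<in> ops V W \<Longrightarrow> R \<in> ops W Z \<Longrightarrow> R o\<^sub>L S \<in> ops V Z"
  by (auto simp: ops_def clinear_op_compose)

lemma ops_apply_proj:
  assumes "T \<in> ops V W" "x - v \<in> ccomplement V"
  shows "T x = T v"
  using opsD(2)[OF assms] by (simp add: blinfun.diff_right)

lemma ops_eqI:
  assumes V: "closed_csubspace V" and T: "S \<in> ops V W" "T \<in> ops V W'"
    and eq: "\<And>v. v \<in> V \<Longrightarrow> S v = T v"
  shows "S = T"
proof (rule blinfun_eqI)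
  fix x
  obtain v where "v \<in> V" "x - v \<in> ccomplement V"
    using ex_ccomplement_decomposition[OF V] by blast
  then show "S x = T x"
    using eq ops_apply_proj T by metis
qed

lemma ops_cadj:
  assumes W: "closed_csubspace W" and V: "closed_csubspace V" and T: "T \<in> ops V W"
  shows "cadj T \<in> ops W V"
proof -
  note T' = opsD[OF T]
  have "cadj T u = 0" if u: "u \<in> ccomplement W" for u
  proof (rule inner_right_eqI)
    fix x
    have "inner u (T x) = 0"
      using u T'(3)[of x] ccomplement_inner[OF W] by blast
    then show "inner x (cadj T u) = inner x 0"
      using inner_cadj[OF T'(1), of x u] by (simp add: inner_commute)
  qed
  moreover have "cadj T x \<in> V" for x
  proof (rule ccomplement_ccomplement[OF V])
    fix u assume "u \<in> ccomplement V"
    then show "inner (cadj T x) u = 0"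
      using T'(2) inner_cadj[OF T'(1), of u x] by (simp add: inner_commute)
  qed
  ultimately show ?thesis
    using clinear_op_cadj[OF T'(1)] by (simp add: ops_def)
qed

text \<open>A bounded complex-linear map on a closed subspace, extended by zero on the complement.\<close>

lemma ex_extension_by_zero:
  fixes f :: "'h::chilbert_space \<Rightarrow> 'h"
  assumes V: "closed_csubspace V"
    and add: "\<And>x y. x \<in> V \<Longrightarrow> y \<in> V \<Longrightarrow> f (x + y) = f x + f y"
    and scale: "\<And>c x. x \<in> V \<Longrightarrow> f (scaleC c x) = scaleC c (f x)"
    and bound: "\<And>x. x \<in> V \<Longrightarrow> norm (f x) \<le> K * norm x" and "0 \<le> K"
    and W: "\<And>x. x \<in> V \<Longrightarrow> f x \<in> W"
  shows "\<exists>T\<in>ops V W. norm T \<le> K \<and> (\<forall>v\<in>V. blinfun_apply T v = f v)"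
proof -
  have sV: "subspace V" and cV: "\<And>c x. x \<in> V \<Longrightarrow> scaleC c x \<in> V"
    using V by (auto simp: closed_csubspace_def)
  \<comment> \<open>\<open>p\<close> is the orthogonal projection onto \<open>V\<close>.\<close>
  obtain p where p: "\<And>x. p x \<in> V" "\<And>x. x - p x \<in> ccomplement V"
    using ex_ccomplement_decomposition[OF V] by metis
  have p_eqI: "p x = v" if "v \<in> V" "x - v \<in> ccomplement V" for x v
  proof -
    have "p x - v \<in> V"
      using p(1) that(1) sV by (simp add: subspace_diff)
    then have "inner (x - v) (p x - v) = 0" "inner (x - p x) (p x - v) = 0"
      using p(2) that(2) ccomplement_inner[OF V] by blast+
    then have "inner (p x - v) (p x - v) = 0"
      by (simp add: inner_diff_left)
    then show ?thesis by simp
  qed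
  have p_add: "p (x + y) = p x + p y" for x y
    using subspace_add[OF subspace_ccomplement[OF V] p(2)[of x] p(2)[of y]]
    by (intro p_eqI) (simp_all add: p(1) sV subspace_add algebra_simps)
  have p_scaleC: "p (scaleC c x) = scaleC c (p x)" for c x
    using scaleC_ccomplement[OF p(2)[of x], of c]
    by (intro p_eqI) (simp_all add: p(1) cV scaleC_diff_right)
  have p_norm: "norm (p x) \<le> norm x" for x
  proof -
    have "inner (x - p x) (p x) = 0"
      using p ccomplement_inner[OF V] by blast
    then have "norm (p x) * norm (p x) = inner x (p x)"
      by (simp add: inner_diff_left power2_norm_eq_inner[symmetric] power2_eq_square)
    also have "\<dots> \<le> norm x * norm (p x)"
      by (rule norm_cauchy_schwarz)
    finally show ?thesis
      by (cases "p x = 0") auto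
  qed
  have lin: "bounded_linear (\<lambda>x. f (p x))"
  proof (rule bounded_linear_intro[where K = K])
    show "f (p (r *\<^sub>R x)) = r *\<^sub>R f (p x)" for r x
      by (simp add: scaleC_of_real[symmetric] p_scaleC scale p(1))
    show "norm (f (p x)) \<le> norm x * K" for x
      using order_trans[OF bound[OF p(1)] mult_left_mono[OF p_norm \<open>0 \<le> K\<close>]]
      by (simp add: mult.commute)
  qed (simp add: p_add add p(1))
  define T where "T = Blinfun (\<lambda>x. f (p x))"
  have T: "T x = f (p x)" for x
    by (simp add: T_def bounded_linear_Blinfun_apply[OF lin])
  have f0: "f 0 = 0"
    using add[of 0 0] subspace_0[OF sV] by simp
  have "T \<in> ops V W"
    unfolding ops_def clinear_op_def
    by (auto simp: T p_scaleC scale p(1) W f0 p_eqI[OF subspace_0[OF sV]])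
  moreover have "norm T \<le> K"
    using order_trans[OF bound[OF p(1)] mult_left_mono[OF p_norm \<open>0 \<le> K\<close>]] \<open>0 \<le> K\<close>
    by (intro norm_blinfun_bound) (auto simp: T)
  moreover have "T v = f v" if "v \<in> V" for v
    using that p_eqI[OF that] subspace_0[OF subspace_ccomplement[OF V]] by (simp add: T)
  ultimately show ?thesis by blast
qed

lemma LIMSEQ_in_closure:
  fixes f :: "nat \<Rightarrow> 'a::metric_space"
  assumes "\<And>n. f n \<in> S" "f \<longlonglongrightarrow> x"
  shows "x \<in> closure S"
  unfolding closure_sequential using assms by (intro exI[of _ f]) simp

lemma subspace_closure:
  fixes V :: "'a::real_normed_vector set"
  assumes "subspace V"
  shows "subspace (closure V)"
proof (rule subspaceI)
  show "0 \<in> closure V"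
    using subspace_0[OF assms] closure_subset by blast
  fix x y and c :: real
  assume "x \<in> closure V"
  then obtain f where f: "\<And>n. f n \<in> V" "f \<longlonglongrightarrow> x"
    by (auto simp: closure_sequential)
  show "c *\<^sub>R x \<in> closure V"
    by (rule LIMSEQ_in_closure[OF subspace_scale[OF assms f(1)] tendsto_scaleR[OF tendsto_const f(2)]])
  assume "y \<in> closure V"
  then obtain g where g: "\<And>n. g n \<in> V" "g \<longlonglongrightarrow> y"
    by (auto simp: closure_sequential)
  show "x + y \<in> closure V"
    by (rule LIMSEQ_in_closure[OF subspace_add[OF assms f(1) g(1)] tendsto_add[OF f(2) g(2)]])
qed

lemma closed_csubspace_closure_range:
  assumes "clinear_op S"
  shows "closed_csubspace (closure (range S))"
  unfolding closed_csubspace_def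
proof (intro conjI allI ballI)
  show "subspace (closure (range S))"
    by (intro subspace_closure linear_subspace_image bounded_linear.linear
        blinfun.bounded_linear_right subspace_UNIV)
  fix c x assume "x \<in> closure (range S)"
  then obtain f where f: "\<And>n. f n \<in> range S" "f \<longlonglongrightarrow> x"
    by (auto simp: closure_sequential)
  have "scaleC c (f n) \<in> range S" for n
    using f(1)[of n] clinear_op_scaleC[OF assms] by (metis imageE rangeI)
  then show "scaleC c x \<in> closure (range S)"
    by (rule LIMSEQ_in_closure[OF _ bounded_linear.tendsto[OF bounded_linear_scaleC f(2)]])
qed simp

lemma ops_closure_range_eqI:
  assumes "clinear_op S" and C: "C \<in> ops (closure (range S)) W" "D \<in> ops (closure (range S)) W'"
    and eq: "\<And>h. C (S h) = D (S h)"
  shows "C = D"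
proof (rule ops_eqI[OF closed_csubspace_closure_range[OF assms(1)] C])
  have "closure (range S) \<subseteq> {v. C v = D v}"
    by (intro closure_minimal closed_Collect_eq continuous_intros) (auto simp: eq)
  then show "C v = D v" if "v \<in> closure (range S)" for v
    using that by blast
qed

text \<open>Douglas factorization: if \<open>norm (T h) \<le> norm (S h)\<close> for all \<open>h\<close>, then \<open>T = C S\<close> for a contraction
  \<open>C\<close> between the closed ranges.  The closure of \<open>{(S h, T h)}\<close> is the graph of \<open>C\<close>.\<close>

lemma ex_contraction_factor:
  fixes S T :: "'h::chilbert_space \<Rightarrow>\<^sub>L 'h"
  assumes S: "clinear_op S" and T: "clinear_op T" and le: "\<And>h. norm (T h) \<le> norm (S h)"
  shows "\<exists>C\<in>ops (closure (range S)) (closure (range T)). norm C \<le> 1 \<and> (\<forall>h. blinfun_apply C (S h) = T h)"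
proof -
  define G where "G x y \<longleftrightarrow> (\<exists>h. (\<lambda>n. S (h n)) \<longlonglongrightarrow> x \<and> (\<lambda>n. T (h n)) \<longlonglongrightarrow> y)" for x y
  have G_I: "G x y" if "(\<lambda>n. S (h n)) \<longlonglongrightarrow> x" "(\<lambda>n. T (h n)) \<longlonglongrightarrow> y" for h x y
    unfolding G_def using that by (intro exI[of _ h] conjI)
  have G_E: thesis
    if "G x y" "\<And>h. (\<lambda>n. S (h n)) \<longlonglongrightarrow> x \<Longrightarrow> (\<lambda>n. T (h n)) \<longlonglongrightarrow> y \<Longrightarrow> thesis" for x y thesis
    using that(1) unfolding G_def by (elim exE conjE) (rule that(2))
  have G_add: "G (x + x') (y + y')" if G: "G x y" "G x' y'" for x x' y y'
  proof -
    obtain h where h: "(\<lambda>n. S (h n)) \<longlonglongrightarrow> x" "(\<lambda>n. T (h n)) \<longlonglongrightarrow> y"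
      using G(1) by (rule G_E)
    obtain h' where h': "(\<lambda>n. S (h' n)) \<longlonglongrightarrow> x'" "(\<lambda>n. T (h' n)) \<longlonglongrightarrow> y'"
      using G(2) by (rule G_E)
    from h h' have "(\<lambda>n. S (h n + h' n)) \<longlonglongrightarrow> x + x'" "(\<lambda>n. T (h n + h' n)) \<longlonglongrightarrow> y + y'"
      by (auto simp: blinfun.add_right intro!: tendsto_add)
    then show ?thesis
      by (rule G_I)
  qed
  have G_scaleC: "G (scaleC c x) (scaleC c y)" if G: "G x y" for c x y
  proof -
    obtain h where h: "(\<lambda>n. S (h n)) \<longlonglongrightarrow> x" "(\<lambda>n. T (h n)) \<longlonglongrightarrow> y"
      using G by (rule G_E)
    have "(\<lambda>n. S (scaleC c (h n))) \<longlonglongrightarrow> scaleC c x" "(\<lambda>n. T (scaleC c (h n))) \<longlonglongrightarrow> scaleC c y"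
      unfolding clinear_op_scaleC[OF S] clinear_op_scaleC[OF T]
      by (intro bounded_linear.tendsto[OF bounded_linear_scaleC] h)+
    then show ?thesis
      by (rule G_I)
  qed
  have G_le: "norm y \<le> norm x" if "G x y" for x y
    using that
  proof (rule G_E)
    fix h assume "(\<lambda>n. S (h n)) \<longlonglongrightarrow> x" "(\<lambda>n. T (h n)) \<longlonglongrightarrow> y"
    then show ?thesis
      using le by (intro LIMSEQ_le[OF tendsto_norm tendsto_norm]) auto
  qed
  \<comment> \<open>The graph is single-valued because \<open>norm y \<le> norm x\<close> on it.\<close>
  have G_unique: "y = y'" if "G x y" "G x y'" for x y y'
  proof -
    have "G (scaleC (-1) x) (scaleC (-1) y')"
      using that(2) by (rule G_scaleC)
    moreover have "scaleC (-1) z = - z" for z :: 'h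
      using scaleC_of_real[of "-1" z] by simp
    ultimately have "G (x + - x) (y + - y')"
      using that(1) by (metis G_add)
    then show ?thesis
      using G_le by fastforce
  qed
  have G_ex: "\<exists>y. G x y" if x: "x \<in> closure (range S)" for x
  proof -
    obtain f where f: "\<And>n. f n \<in> range S" "f \<longlonglongrightarrow> x"
      using x by (auto simp: closure_sequential)
    have "\<forall>n. \<exists>k. f n = S k"
      using f(1) by auto
    from choice[OF this] obtain h where h: "\<And>n. f n = S (h n)"
      by blast
    have "dist (T (h n)) (T (h k)) \<le> dist (f n) (f k)" for n k
      using le[of "h n - h k"] by (simp add: h dist_norm blinfun.diff_right)
    moreover have "Cauchy f"
      using f(2) by (rule LIMSEQ_imp_Cauchy)
    ultimately have "Cauchy (\<lambda>n. T (h n))"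
      unfolding Cauchy_def by (meson order_le_less_trans)
    then obtain y where "(\<lambda>n. T (h n)) \<longlonglongrightarrow> y"
      by (auto simp: Cauchy_convergent_iff convergent_def)
    moreover have "(\<lambda>n. S (h n)) \<longlonglongrightarrow> x"
      using f(2) by (simp add: h[symmetric])
    ultimately show ?thesis
      using G_I by blast
  qed
  have G_S: "G (S h) (T h)" for h
    by (rule G_I[of "\<lambda>_. h"]) simp_all
  have "\<forall>x\<in>closure (range S). \<exists>y. G x y"
    using G_ex by blast
  from bchoice[OF this] obtain f where f: "\<And>x. x \<in> closure (range S) \<Longrightarrow> G x (f x)"
    by blast
  have cs: "closed_csubspace (closure (range S))"
    by (rule closed_csubspace_closure_range[OF S])
  have "\<exists>C\<in>ops (closure (range S)) (closure (range T)). norm C \<le> 1 \<and>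
      (\<forall>v\<in>closure (range S). blinfun_apply C v = f v)"
  proof (rule ex_extension_by_zero[OF cs])
    fix x assume x: "x \<in> closure (range S)"
    show "f x \<in> closure (range T)"
      using f[OF x] by (rule G_E) (rule LIMSEQ_in_closure[OF rangeI])
    show "norm (f x) \<le> 1 * norm x"
      using G_le[OF f[OF x]] by simp
    show "f (scaleC c x) = scaleC c (f x)" for c
      using x cs by (intro G_unique[OF f G_scaleC[OF f[OF x]]]) (auto simp: closed_csubspace_def)
    show "f (x + y) = f x + f y" if "y \<in> closure (range S)" for y
      using cs x that
      by (intro G_unique[OF f G_add[OF f[OF x] f[OF that]]])
        (auto simp: closed_csubspace_def intro: subspace_add)
  qed simp
  then obtain C where C: "C \<in> ops (closure (range S)) (closure (range T))" "norm C \<le> 1"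
      "\<And>v. v \<in> closure (range S) \<Longrightarrow> C v = f v"
    by blast
  have S_in: "S h \<in> closure (range S)" for h
    by (rule subsetD[OF closure_subset rangeI])
  have "C (S h) = T h" for h
    unfolding C(3)[OF S_in] by (rule G_unique[OF f[OF S_in] G_S])
  with C(1,2) show ?thesis by blast
qed

text \<open>The positive square root in \<open>B(V)\<close> is the one in \<open>B(H)\<close>, which vanishes where \<open>T\<close> does.\<close>

lemma op_sqrt_ops:
  assumes V: "closed_csubspace V" and T: "T \<in> ops V V" "positive_op T"
  shows "op_sqrt V T \<in> ops V V" "positive_op (op_sqrt V T)" "op_sqrt V T o\<^sub>L op_sqrt V T = T"
proof -
  obtain R where R: "positive_op R" "R o\<^sub>L R = T" "\<And>S. positive_op S \<Longrightarrow> S o\<^sub>L S = T \<Longrightarrow> S = R"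
    using ex1_positive_sqrt[OF T(2)] by blast
  note R' = positive_opD[OF R(1)]
  have R0: "R u = 0" if "u \<in> ccomplement V" for u
  proof -
    have "inner (R u) (R u) = inner u (T u)"
      by (simp add: R'(2) R(2)[symmetric])
    then show ?thesis
      using opsD(2)[OF T(1) that] by simp
  qed
  have "R x \<in> V" for x
    by (rule ccomplement_ccomplement[OF V]) (simp add: R'(2) R0)
  then have "R \<in> ops V V"
    using R'(1) R0 by (simp add: ops_def)
  then have "op_sqrt V T = R"
    unfolding op_sqrt_def using R by (intro the_equality) blast+
  then show "op_sqrt V T \<in> ops V V" "positive_op (op_sqrt V T)" "op_sqrt V T o\<^sub>L op_sqrt V T = T"
    using R(1,2) \<open>R \<in> ops V V\<close> by simp_all
qed

text \<open>A symmetric operator on \<open>V\<close> that is bounded below is invertible in \<open>B(V)\<close>: its range is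
  closed, and a vector of \<open>V\<close> orthogonal to the range lies in the kernel.\<close>

lemma op_inv_ops:
  fixes R :: "'h::chilbert_space \<Rightarrow>\<^sub>L 'h"
  assumes V: "closed_csubspace V" and R: "R \<in> ops V V"
    and sym: "\<And>x y. inner (R x) y = inner x (R y)"
    and below: "\<And>v. v \<in> V \<Longrightarrow> e * norm v \<le> norm (R v)" and "0 < e"
  shows "op_inv V R \<in> ops V V" "v \<in> V \<Longrightarrow> op_inv V R (R v) = v" "v \<in> V \<Longrightarrow> R (op_inv V R v) = v"
    "cadj (op_inv V R) = op_inv V R"
proof -
  have sV: "subspace V" and clV: "closed V" and cV: "\<And>c x. x \<in> V \<Longrightarrow> scaleC c x \<in> V"
    using V by (auto simp: closed_csubspace_def)
  note R' = opsD[OF R]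
  have inj: "v = v'" if "v \<in> V" "v' \<in> V" "R v = R v'" for v v'
    using below[OF subspace_diff[OF sV that(1,2)]] that(3) \<open>0 < e\<close>
    by (simp add: blinfun.diff_right mult_le_0_iff)
  have lin: "linear R"
    by (intro bounded_linear.linear blinfun.bounded_linear_right)
  have "complete (R ` V)"
    using complete_isometric_image[OF \<open>0 < e\<close> sV blinfun.bounded_linear_right, of R] below clV
    by (simp add: complete_eq_closed mult.commute)
  then have "closed (R ` V)"
    by (rule complete_imp_closed)
  have surj: "\<exists>z\<in>V. R z = v" if v: "v \<in> V" for v
  proof -
    obtain y where y: "y \<in> V" "\<forall>w\<in>R ` V. inner (v - R y) w = 0"
      using ex_orthogonal_projection[OF linear_subspace_image[OF lin sV] \<open>closed (R ` V)\<close>] by blast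
    define u where "u = v - R y"
    have "u \<in> V"
      unfolding u_def by (intro subspace_diff sV v R'(3))
    moreover have "inner (R u) (R u) = 0"
      using y(2) R'(3) by (simp add: u_def[symmetric] sym)
    ultimately have "u = 0"
      using inj[of u 0] subspace_0[OF sV] by simp
    then show ?thesis
      using y(1) by (auto simp: u_def)
  qed
  then obtain g where g: "\<And>v. v \<in> V \<Longrightarrow> g v \<in> V" "\<And>v. v \<in> V \<Longrightarrow> R (g v) = v"
    by metis
  have "\<exists>Q\<in>ops V V. norm Q \<le> 1 / e \<and> (\<forall>v\<in>V. blinfun_apply Q v = g v)"
  proof (rule ex_extension_by_zero[OF V])
    fix x assume x: "x \<in> V"
    show "norm (g x) \<le> 1 / e * norm x"
      using below[OF g(1)[OF x]] g(2)[OF x] \<open>0 < e\<close> by (simp add: field_simps)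
    show "g (scaleC c x) = scaleC c (g x)" for c
      by (rule inj) (use x in \<open>simp_all add: g cV clinear_op_scaleC[OF R'(1)]\<close>)
    show "g (x + y) = g x + g y" if "y \<in> V" for y
      by (rule inj) (use x that in \<open>simp_all add: g blinfun.add_right subspace_add sV\<close>)
  qed (use g \<open>0 < e\<close> in auto)
  then obtain Q where Q: "Q \<in> ops V V" "\<And>v. v \<in> V \<Longrightarrow> Q v = g v"
    by blast
  have QR: "Q (R v) = v \<and> R (Q v) = v" if v: "v \<in> V" for v
    using inj[of "g (R v)" v] v by (simp add: Q(2) g R'(3))
  have "op_inv V R = Q"
    unfolding op_inv_def
  proof (rule the_equality)
    show "Q \<in> ops V V \<and> (\<forall>v\<in>V. Q (R v) = v \<and> R (Q v) = v)"
      using Q(1) QR by blast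
    fix P assume P: "P \<in> ops V V \<and> (\<forall>v\<in>V. P (R v) = v \<and> R (P v) = v)"
    show "P = Q"
    proof (rule ops_eqI[OF V conjunct1[OF P] Q(1)])
      fix v assume v: "v \<in> V"
      have "P (R (Q v)) = Q v"
        using P opsD(3)[OF Q(1)] by blast
      then show "P v = Q v"
        using QR[OF v] by simp
    qed
  qed
  moreover have "cadj Q = Q"
  proof (rule cadj_eqI)
    fix x y
    obtain v where v: "v \<in> V" "x - v \<in> ccomplement V"
      using ex_ccomplement_decomposition[OF V] by blast
    obtain w where w: "w \<in> V" "y - w \<in> ccomplement V"
      using ex_ccomplement_decomposition[OF V] by blast
    have "inner (Q v) (y - w) = 0" "inner (x - v) (Q w) = 0"
      using v w opsD(3)[OF Q(1)] ccomplement_inner[OF V] by (auto simp: inner_commute)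
    then have "inner (Q x) y = inner (Q v) w" "inner x (Q y) = inner v (Q w)"
      using ops_apply_proj[OF Q(1)] v(2) w(2) by (simp_all add: inner_diff_left inner_diff_right)
    moreover have "inner (Q v) w = inner v (Q w)"
      using sym[of "Q v" "Q w"] QR v(1) w(1) by simp
    ultimately show "inner (Q x) y = inner x (Q y)" by simp
  qed (rule opsD(1)[OF Q(1)])
  ultimately show "op_inv V R \<in> ops V V" "v \<in> V \<Longrightarrow> op_inv V R (R v) = v"
    "v \<in> V \<Longrightarrow> R (op_inv V R v) = v" "cadj (op_inv V R) = op_inv V R"
    using Q(1) QR by auto
qed

lemma inner_eq_if_isometric_on:
  fixes U :: "'h::chilbert_space \<Rightarrow>\<^sub>L 'h"
  assumes "subspace V" "x \<in> V" "y \<in> V" and eq: "\<And>v. v \<in> V \<Longrightarrow> norm (U v) = norm v"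
  shows "inner (U x) (U y) = inner x y"
proof -
  have "(norm (U (x + y)))\<^sup>2 = (norm (x + y))\<^sup>2" "(norm (U x))\<^sup>2 = (norm x)\<^sup>2"
      "(norm (U y))\<^sup>2 = (norm y)\<^sup>2"
    using assms by (simp_all add: subspace_add)
  then show ?thesis
    by (simp add: power2_norm_eq_inner blinfun.add_right inner_add_left inner_add_right
        inner_commute)
qed

text \<open>Two factors with \<open>S\<^sup>*S = T\<^sup>*T\<close>, that is, with \<open>norm (T h) = norm (S h)\<close> for all \<open>h\<close>,
  differ by a unitary between their closed ranges.\<close>

lemma ex_unitary_factor:
  fixes S T :: "'h::chilbert_space \<Rightarrow>\<^sub>L 'h"
  assumes S: "clinear_op S" and T: "clinear_op T" and eq: "\<And>h. norm (T h) = norm (S h)"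
  shows "\<exists>U. unitary_between (closure (range S)) (closure (range T)) U \<and> (\<forall>h. U (S h) = T h)"
proof -
  let ?V = "closure (range S)" and ?W = "closure (range T)"
  obtain C where C: "C \<in> ops ?V ?W" "norm C \<le> 1" "\<And>h. C (S h) = T h"
    using ex_contraction_factor[OF S T] eq by (metis order_refl)
  obtain D where D: "D \<in> ops ?W ?V" "norm D \<le> 1" "\<And>h. D (T h) = S h"
    using ex_contraction_factor[OF T S] eq by (metis order_refl)
  have contr: "norm (A x) \<le> norm x" if "norm A \<le> 1" for A :: "'h \<Rightarrow>\<^sub>L 'h" and x
    using order_trans[OF norm_blinfun[of A x] mult_right_mono[OF that norm_ge_zero]] by simp
  have "?V \<subseteq> {v. D (C v) = v}"
    by (intro closure_minimal closed_Collect_eq continuous_intros) (auto simp: C(3) D(3))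
  then have DC: "D (C v) = v" if "v \<in> ?V" for v
    using that by blast
  have "?W \<subseteq> {v. C (D v) = v}"
    by (intro closure_minimal closed_Collect_eq continuous_intros) (auto simp: C(3) D(3))
  then have CD: "C (D v) = v" if "v \<in> ?W" for v
    using that by blast
  have iso: "norm (C v) = norm v" if "v \<in> ?V" for v
    using contr[OF C(2), of v] contr[OF D(2), of "C v"] DC[OF that] by simp
  have sV: "subspace ?V" and cV: "\<And>c x. x \<in> ?V \<Longrightarrow> scaleC c x \<in> ?V"
    using closed_csubspace_closure_range[OF S] by (auto simp: closed_csubspace_def)
  have "cinner (C x) (C y) = cinner x y" if "x \<in> ?V" "y \<in> ?V" for x y
  proof (rule cinner_eqI)
    show "inner (scaleC c (C x)) (C y) = inner (scaleC c x) y" for c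
      using inner_eq_if_isometric_on[OF sV cV[OF that(1), of c] that(2) iso]
      by (simp add: clinear_op_scaleC[OF opsD(1)[OF C(1)]])
  qed
  moreover have "C ` ?V = ?W"
  proof
    show "C ` ?V \<subseteq> ?W"
      using opsD(3)[OF C(1)] by auto
    show "?W \<subseteq> C ` ?V"
      using CD opsD(3)[OF D(1)] by (metis imageI subsetI)
  qed
  ultimately show ?thesis
    using C unfolding unitary_between_def by blast
qed

lemma unitary_cadj_cancel:
  assumes V: "closed_csubspace V" and W: "closed_csubspace W"
    and U: "unitary_between V W U" and v: "v \<in> V"
  shows "cadj U (U v) = v"
proof -
  have ops: "U \<in> ops V W" and iso: "\<And>x y. x \<in> V \<Longrightarrow> y \<in> V \<Longrightarrow> inner (U x) (U y) = inner x y"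
    using U by (auto simp: unitary_between_def inner_eq_Re_cinner)
  define z where "z = cadj U (U v) - v"
  have "z \<in> V"
    unfolding z_def using opsD(3)[OF ops_cadj[OF W V ops]] v V
    by (auto simp: closed_csubspace_def intro: subspace_diff)
  then have "inner z z = 0"
    using iso[OF _ v, of z] inner_cadj[OF opsD(1)[OF ops], of z "U v"]
    by (subst (2) z_def) (simp add: inner_diff_right)
  then show ?thesis
    by (simp add: z_def)
qed

section \<open>Cylinder values of operator-valued measures\<close>

lemma sets_cyl: "cyl m w \<in> sets (Omega m)"
proof -
  have "{x \<in> space (Omega m). x i = c} \<in> sets (Omega m)" for i c
    unfolding Omega_def by measurable
  then show ?thesis
    unfolding cyl_def by (intro sets.sets_Collect_finite_All' sets.sets_Collect) auto
qed

lemma cyl_append_subset: "cyl m (w @ v) \<subseteq> cyl m w"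
  by (auto simp: cyl_def nth_append)

lemma povm_mono:
  assumes E: "povm m E" and A: "A \<in> sets (Omega m)" and B: "B \<in> sets (Omega m)" and "A \<subseteq> B"
  shows "inner (E A x) x \<le> inner (E B x) x"
proof -
  have add: "(\<lambda>n::nat. cinner (E (F n) x) x) sums cinner (E (\<Union>n. F n) x) x"
    if "range F \<subseteq> sets (Omega m)" "disjoint_family F" for F
    using E that by (auto simp: povm_def)
  \<comment> \<open>A constant series converges only if its term is \<open>0\<close>.\<close>
  have "(\<lambda>n::nat. cinner (E {} x) x) sums cinner (E {} x) x"
    using add[of "\<lambda>_. {}"] by (simp add: disjoint_family_on_def)
  then have "summable (\<lambda>n::nat. cinner (E {} x) x)"
    by (rule sums_summable)
  then have "(\<lambda>n::nat. cinner (E {} x) x) \<longlonglongrightarrow> 0"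
    by (rule summable_LIMSEQ_zero)
  then have E0: "cinner (E {} x) x = 0"
    by (simp only: LIMSEQ_const_iff)
  \<comment> \<open>The disjoint sequence \<open>A\<close>, \<open>B - A\<close>, \<open>{}\<close>, \<open>{}\<close>, \<open>\<dots>\<close> turns countable into finite additivity.\<close>
  define F where "F n = (if n = 0 then A else if n = 1 then B - A else {})" for n :: nat
  have "range F \<subseteq> sets (Omega m)" "disjoint_family F"
    using A B by (auto simp: F_def disjoint_family_on_def)
  moreover have "(\<Union>n. F n) = B"
    using \<open>A \<subseteq> B\<close> by (auto simp: F_def split: if_splits)
  ultimately have "(\<lambda>n. cinner (E (F n) x) x) sums cinner (E B x) x"
    using add[of F] by simp
  moreover have "(\<lambda>n. cinner (E (F n) x) x) sums (\<Sum>n\<in>{0,1}. cinner (E (F n) x) x)"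
    by (rule sums_finite) (auto simp: F_def E0)
  ultimately have "cinner (E B x) x = (\<Sum>n\<in>{0,1}. cinner (E (F n) x) x)"
    by (rule sums_unique2)
  then have "cinner (E B x) x = cinner (E A x) x + cinner (E (B - A) x) x"
    by (simp add: F_def)
  moreover have "0 \<le> Re (cinner (E (B - A) x) x)"
    using E A B by (auto simp: povm_def positive_op_def complex_nonneg_Reals_iff)
  ultimately show ?thesis
    by (simp add: inner_eq_Re_cinner)
qed

lemma povm_root_sqrt:
  assumes "povm m E"
  shows "positive_op (povm_root m E w)" "povm_root m E w o\<^sub>L povm_root m E w = E (cyl m w)"
proof -
  have "positive_op (E (cyl m w))"
    using assms sets_cyl by (auto simp: povm_def)
  then show "positive_op (povm_root m E w)" "povm_root m E w o\<^sub>L povm_root m E w = E (cyl m w)"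
    unfolding povm_root_def
    using op_sqrt_ops(2,3)[OF closed_csubspace_UNIV ops_UNIV_iff[THEN iffD2, OF positive_opD(1)]]
    by blast+
qed

lemma norm_povm_root:
  assumes "povm m E"
  shows "(norm (povm_root m E w h))\<^sup>2 = inner (E (cyl m w) h) h"
  unfolding power2_norm_eq_inner povm_root_sqrt(2)[OF assms, symmetric]
  by (simp add: positive_opD(2)[OF povm_root_sqrt(1)[OF assms]])

lemma closed_csubspace_range_space:
  assumes "povm m E"
  shows "closed_csubspace (range_space m E w)"
  unfolding range_space_def
  by (intro closed_csubspace_closure_range positive_opD(1) povm_root_sqrt(1) assms)

lemma povm_root_in_range_space: "povm_root m E w h \<in> range_space m E w"
  unfolding range_space_def by (rule subsetD[OF closure_subset rangeI])

text \<open>An operator on the range space is determined by its values on the range of the root.\<close>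

lemma range_space_eqI:
  assumes "povm m E" "S \<in> ops (range_space m E w) W" "T \<in> ops (range_space m E w) W'"
    and "\<And>h. S (povm_root m E w h) = T (povm_root m E w h)"
  shows "S = T"
  by (rule ops_closure_range_eqI[OF positive_opD(1)[OF povm_root_sqrt(1)[OF assms(1)]]
        assms(2,3)[unfolded range_space_def] assms(4)])

text \<open>Existence and uniqueness of the edge contraction, by the monotonicity of \<open>E\<close> on cylinders.\<close>

lemma edge_contraction:
  assumes E: "povm m E"
  shows "edge_contraction m E w j \<in> ops (range_space m E w) (range_space m E (w @ [j]))"
    and "norm (edge_contraction m E w j) \<le> 1"
    and "edge_contraction m E w j (povm_root m E w h) = povm_root m E (w @ [j]) h"
proof -
  have lin: "clinear_op (povm_root m E v)" for v
    by (rule positive_opD(1)[OF povm_root_sqrt(1)[OF E]])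
  have le: "norm (povm_root m E (w @ [j]) h) \<le> norm (povm_root m E w h)" for h
  proof (rule power2_le_imp_le)
    show "(norm (povm_root m E (w @ [j]) h))\<^sup>2 \<le> (norm (povm_root m E w h))\<^sup>2"
      unfolding norm_povm_root[OF E] by (rule povm_mono[OF E sets_cyl sets_cyl cyl_append_subset])
  qed simp
  obtain C where C: "C \<in> ops (range_space m E w) (range_space m E (w @ [j]))" "norm C \<le> 1"
      "\<And>h. C (povm_root m E w h) = povm_root m E (w @ [j]) h"
    using ex_contraction_factor[OF lin lin le] unfolding range_space_def by blast
  have "edge_contraction m E w j = C"
    unfolding edge_contraction_def
    using C range_space_eqI[OF E] by (intro the_equality) auto
  with C show "edge_contraction m E w j \<in> ops (range_space m E w) (range_space m E (w @ [j]))"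
    "norm (edge_contraction m E w j) \<le> 1"
    "edge_contraction m E w j (povm_root m E w h) = povm_root m E (w @ [j]) h"
    by auto
qed

text \<open>\<open>C\<^sup>*C\<close> satisfies the defining properties; uniqueness holds because \<open>R A R\<close> determines the form
  \<open>inner (R k) (A (R h))\<close> and hence, by density, \<open>A\<close>.\<close>

lemma splitting_op_eq:
  assumes E: "povm m E"
  shows "splitting_op m E w j = cadj (edge_contraction m E w j) o\<^sub>L edge_contraction m E w j"
proof -
  let ?V = "range_space m E w" and ?R = "povm_root m E w" and ?R' = "povm_root m E (w @ [j])"
  define C where "C = edge_contraction m E w j"
  note V = closed_csubspace_range_space[OF E]
  note R = povm_root_sqrt[OF E]
  have C: "C \<in> ops ?V (range_space m E (w @ [j]))" "norm C \<le> 1" "\<And>h. C (?R h) = ?R' h"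
    using edge_contraction[OF E] by (simp_all add: C_def)
  note adj = inner_cadj[OF opsD(1)[OF C(1)]]
  have ops: "cadj C o\<^sub>L C \<in> ops ?V ?V"
    by (rule ops_compose[OF C(1) ops_cadj[OF V V C(1)]])
  have pos: "positive_op (cadj C o\<^sub>L C)"
    by (rule positive_op_cadj_compose[OF opsD(1)[OF C(1)]])
  have "norm (cadj C o\<^sub>L C) \<le> 1"
  proof (rule norm_positive_op_le_1[OF pos])
    fix x
    have "inner ((cadj C o\<^sub>L C) x) x = (norm (C x))\<^sup>2"
      using adj[of x "C x"] by (simp add: power2_norm_eq_inner inner_commute)
    also have "\<dots> \<le> (norm x)\<^sup>2"
      using order_trans[OF norm_blinfun[of C x] mult_right_mono[OF C(2) norm_ge_zero]]
      by (intro power_mono) simp_all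
    finally show "inner ((cadj C o\<^sub>L C) x) x \<le> (norm x)\<^sup>2" .
  qed
  moreover have "E (cyl m (w @ [j])) = ?R o\<^sub>L (cadj C o\<^sub>L C) o\<^sub>L ?R"
  proof (rule blinfun_eqI, rule inner_right_eqI)
    fix h x
    have "inner x ((?R o\<^sub>L (cadj C o\<^sub>L C) o\<^sub>L ?R) h) = inner (?R x) (cadj C (C (?R h)))"
      by (simp add: positive_opD(2)[OF R(1)])
    also have "\<dots> = inner (?R' x) (?R' h)"
      using adj[of "?R x" "C (?R h)"] by (simp add: C(3))
    also have "\<dots> = inner x ((?R' o\<^sub>L ?R') h)"
      by (simp add: positive_opD(2)[OF R(1)])
    finally show "inner x (E (cyl m (w @ [j])) h) = inner x ((?R o\<^sub>L (cadj C o\<^sub>L C) o\<^sub>L ?R) h)"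
      by (simp only: R(2))
  qed
  moreover have "A = B"
    if A: "A \<in> ops ?V ?V" and B: "B \<in> ops ?V ?V" and eq: "?R o\<^sub>L A o\<^sub>L ?R = ?R o\<^sub>L B o\<^sub>L ?R" for A B
  proof (rule range_space_eqI[OF E A B])
    fix h
    define z where "z = A (?R h) - B (?R h)"
    have "z \<in> ?V"
      unfolding z_def using opsD(3)[OF A] opsD(3)[OF B] V
      by (auto simp: closed_csubspace_def intro: subspace_diff)
    have "?R (A (?R h)) = ?R (B (?R h))"
      using eq by (metis blinfun_apply_blinfun_compose)
    then have "inner (?R k) z = 0" for k
      by (simp add: positive_opD(2)[OF R(1)] z_def blinfun.diff_right)
    then have "?V \<subseteq> {v. inner v z = 0}"
      unfolding range_space_def
      by (intro closure_minimal closed_Collect_eq continuous_intros) auto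
    then have "inner z z = 0"
      using \<open>z \<in> ?V\<close> by blast
    then show "A (?R h) = B (?R h)"
      by (simp add: z_def)
  qed
  ultimately show ?thesis
    unfolding splitting_op_def C_def[symmetric]
    using ops pos by (intro the_equality) auto
qed

section \<open>Factor space coordinates\<close>

text \<open>A lower bound for \<open>X w\<close> on the range space makes its square root bounded below there.\<close>

lemma X_root:
  assumes E: "povm m E" and X: "range_martingale m E X" and sp: "strictly_positive m E X"
    and w: "w \<in> words m"
  shows "X_root m E X w \<in> ops (range_space m E w) (range_space m E w)"
    and "positive_op (X_root m E X w)"
    and "X_root m E X w o\<^sub>L X_root m E X w = X w"
    and "\<exists>e>0. \<forall>v\<in>range_space m E w. e * norm v \<le> norm (X_root m E X w v)"
proof -
  let ?V = "range_space m E w"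
  note V = closed_csubspace_range_space[OF E]
  have Xw: "X w \<in> ops ?V ?V" "cadj (X w) = X w"
    using X w by (auto simp: range_martingale_def)
  obtain a where a: "0 < a" "op_le_on ?V (a *\<^sub>R id_blinfun) (X w)"
    using sp w by (auto simp: strictly_positive_def)
  have below: "a * (norm v)\<^sup>2 \<le> inner (X w v) v" if "v \<in> ?V" for v
  proof -
    have "0 \<le> Re (cinner ((X w - a *\<^sub>R id_blinfun) v) v)"
      using a(2) that by (auto simp: op_le_on_def complex_nonneg_Reals_iff)
    then have "0 \<le> inner ((X w - a *\<^sub>R id_blinfun) v) v"
      by (simp only: inner_eq_Re_cinner)
    then show ?thesis
      by (simp add: blinfun.bilinear_simps inner_diff_left power2_norm_eq_inner)
  qed
  have sym: "inner (X w x) y = inner x (X w y)" for x y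
    using inner_cadj[OF opsD(1)[OF Xw(1)]] Xw(2) by simp
  have nonneg: "0 \<le> inner (X w x) x" for x
  proof -
    obtain v where v: "v \<in> ?V" "x - v \<in> ccomplement ?V"
      using ex_ccomplement_decomposition[OF V] by blast
    have "inner (x - v) (X w v) = 0"
      using v(2) opsD(3)[OF Xw(1)] ccomplement_inner[OF V] by blast
    then have "inner (X w v) (x - v) = 0"
      by (simp only: inner_commute)
    then have "inner (X w x) x = inner (X w v) v"
      using ops_apply_proj[OF Xw(1) v(2)] by (simp add: inner_diff_right)
    moreover have "0 \<le> a * (norm v)\<^sup>2"
      using a(1) by simp
    ultimately show ?thesis
      using below[OF v(1)] by linarith
  qed
  have "positive_op (X w)"
    unfolding positive_op_iff using opsD(1)[OF Xw(1)] sym nonneg by blast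
  note R = op_sqrt_ops[OF V Xw(1) this, folded X_root_def]
  have "sqrt a * norm v \<le> norm (X_root m E X w v)" if "v \<in> ?V" for v
  proof (rule power2_le_imp_le)
    have "(norm (X_root m E X w v))\<^sup>2 = inner ((X_root m E X w o\<^sub>L X_root m E X w) v) v"
      by (simp add: power2_norm_eq_inner positive_opD(2)[OF R(2)])
    then show "(sqrt a * norm v)\<^sup>2 \<le> (norm (X_root m E X w v))\<^sup>2"
      using below[OF that] a(1) by (simp add: R(3) power_mult_distrib)
  qed simp
  then show "\<exists>e>0. \<forall>v\<in>?V. e * norm v \<le> norm (X_root m E X w v)"
    using a(1) by (intro exI[of _ "sqrt a"]) simp
  show "X_root m E X w \<in> ops ?V ?V" "positive_op (X_root m E X w)"
    "X_root m E X w o\<^sub>L X_root m E X w = X w"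
    using R by auto
qed

lemma X_inv_root:
  assumes E: "povm m E" and X: "range_martingale m E X" and sp: "strictly_positive m E X"
    and w: "w \<in> words m"
  shows "X_inv_root m E X w \<in> ops (range_space m E w) (range_space m E w)"
    and "v \<in> range_space m E w \<Longrightarrow> X_inv_root m E X w (X_root m E X w v) = v"
    and "v \<in> range_space m E w \<Longrightarrow> X_root m E X w (X_inv_root m E X w v) = v"
    and "cadj (X_inv_root m E X w) = X_inv_root m E X w"
proof -
  note R = X_root[OF E X sp w]
  obtain e where "0 < e" "\<And>v. v \<in> range_space m E w \<Longrightarrow> e * norm v \<le> norm (X_root m E X w v)"
    using R(4) by blast
  note inv = op_inv_ops[OF closed_csubspace_range_space[OF E] R(1) positive_opD(2)[OF R(2)] this(2,1),
      folded X_inv_root_def]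
  show "X_inv_root m E X w \<in> ops (range_space m E w) (range_space m E w)"
    "v \<in> range_space m E w \<Longrightarrow> X_inv_root m E X w (X_root m E X w v) = v"
    "v \<in> range_space m E w \<Longrightarrow> X_root m E X w (X_inv_root m E X w v) = v"
    "cadj (X_inv_root m E X w) = X_inv_root m E X w"
    using inv by auto
qed

text \<open>The factor map has dense range in the range space, since the square root of \<open>X w\<close> is a
  homeomorphism of that space.\<close>

lemma closure_range_factor_map:
  assumes E: "povm m E" and X: "range_martingale m E X" and sp: "strictly_positive m E X"
    and w: "w \<in> words m"
  shows "closure (range (factor_map m E X w)) = range_space m E w"
proof
  note R = X_root[OF E X sp w] and Q = X_inv_root[OF E X sp w]
  show "closure (range (factor_map m E X w)) \<subseteq> range_space m E w"
    using opsD(3)[OF R(1)] closed_csubspace_range_space[OF E, of w]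
    by (intro closure_minimal) (auto simp: factor_map_def closed_csubspace_def)
  show "range_space m E w \<subseteq> closure (range (factor_map m E X w))"
  proof
    fix v assume v: "v \<in> range_space m E w"
    have "X_inv_root m E X w v \<in> closure (range (povm_root m E w))"
      using opsD(3)[OF Q(1)] by (simp add: range_space_def)
    then obtain f where f: "\<And>n. f n \<in> range (povm_root m E w)" "f \<longlonglongrightarrow> X_inv_root m E X w v"
      by (auto simp: closure_sequential)
    have "(\<lambda>n. X_root m E X w (f n)) \<longlonglongrightarrow> X_root m E X w (X_inv_root m E X w v)"
      by (intro blinfun.tendsto tendsto_const f(2))
    moreover have "X_root m E X w (f n) \<in> range (factor_map m E X w)" for n
      using f(1)[of n] by (auto simp: factor_map_def)
    ultimately show "v \<in> closure (range (factor_map m E X w))"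
      unfolding Q(3)[OF v] by (intro LIMSEQ_in_closure)
  qed
qed

text \<open>Existence and uniqueness of the coordinate unitary.  It is available because \<open>F\<close> has the
  cylinder value \<open>S\<^sup>*S\<close> for the factor map \<open>S\<close>, so that \<open>S\<close> and the root of \<open>F\<close> have equal
  norms on every vector.\<close>

lemma factor_unitary:
  assumes E: "povm m E" and X: "range_martingale m E X" and sp: "strictly_positive m E X"
    and F: "povm m F" and F_cyl: "F (cyl m w) = povm_root m E w o\<^sub>L X w o\<^sub>L povm_root m E w"
    and w: "w \<in> words m"
  shows "unitary_between (range_space m F w) (range_space m E w) (factor_unitary m E X F w)"
    and "factor_unitary m E X F w (povm_root m F w h) = factor_map m E X w h"
proof -
  note R = X_root[OF E X sp w]
  note Ew = povm_root_sqrt[OF E, of w] and Fw = povm_root_sqrt[OF F, of w]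
  have S: "clinear_op (factor_map m E X w)"
    unfolding factor_map_def by (intro clinear_op_compose positive_opD(1) R(2) Ew(1))
  have "norm (factor_map m E X w h) = norm (povm_root m F w h)" for h
  proof -
    have "(norm (factor_map m E X w h))\<^sup>2
        = inner ((X_root m E X w o\<^sub>L X_root m E X w) (povm_root m E w h)) (povm_root m E w h)"
      by (simp add: factor_map_def power2_norm_eq_inner positive_opD(2)[OF R(2)])
    also have "\<dots> = inner (F (cyl m w) h) h"
      unfolding R(3) F_cyl by (simp add: positive_opD(2)[OF Ew(1)])
    finally show ?thesis
      by (simp add: norm_povm_root[OF F, symmetric])
  qed
  then obtain U where U: "unitary_between (range_space m F w) (range_space m E w) U"
      "\<And>h. U (povm_root m F w h) = factor_map m E X w h"
    using ex_unitary_factor[OF positive_opD(1)[OF Fw(1)] S]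
    unfolding closure_range_factor_map[OF E X sp w] range_space_def[of m F, symmetric] by blast
  have "factor_unitary m E X F w = U"
    unfolding factor_unitary_def
    using U range_space_eqI[OF F] by (intro the_equality) (auto simp: unitary_between_def)
  then show "unitary_between (range_space m F w) (range_space m E w) (factor_unitary m E X F w)"
    "factor_unitary m E X F w (povm_root m F w h) = factor_map m E X w h"
    using U by auto
qed

text \<open>Both sides vanish on the complement of the range space and map \<open>factor_map m E X w h\<close> to
  \<open>factor_map m E X (w @ [j]) h\<close>.\<close>

lemma coord_edge_contraction_eq:
  assumes E: "povm m E" and X: "range_martingale m E X" and sp: "strictly_positive m E X"
    and F: "povm m F"
    and F_cyl: "\<And>w. w \<in> words m \<Longrightarrow> F (cyl m w) = povm_root m E w o\<^sub>L X w o\<^sub>L povm_root m E w"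
    and w: "w \<in> words m" and wj: "w @ [j] \<in> words m"
  shows "coord_edge_contraction m E X F w j =
    X_root m E X (w @ [j]) o\<^sub>L edge_contraction m E w j o\<^sub>L X_inv_root m E X w"
proof -
  let ?S = "factor_map m E X w" and ?U = "factor_unitary m E X F w"
  let ?lhs = "coord_edge_contraction m E X F w j"
  let ?rhs = "X_root m E X (w @ [j]) o\<^sub>L edge_contraction m E w j o\<^sub>L X_inv_root m E X w"
  note VE = closed_csubspace_range_space[OF E] and VF = closed_csubspace_range_space[OF F]
  note U = factor_unitary[OF E X sp F F_cyl[OF w] w]
  note U' = factor_unitary[OF E X sp F F_cyl[OF wj] wj]
  have U_ops: "?U \<in> ops (range_space m F w) (range_space m E w)"
    "factor_unitary m E X F (w @ [j]) \<in> ops (range_space m F (w @ [j])) (range_space m E (w @ [j]))"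
    using U(1) U'(1) by (auto simp: unitary_between_def)
  have S: "clinear_op ?S"
    unfolding factor_map_def
    by (intro clinear_op_compose positive_opD(1) X_root(2)[OF E X sp w] povm_root_sqrt(1)[OF E])
  have "?lhs \<in> ops (range_space m E w) (range_space m E (w @ [j]))"
    unfolding coord_edge_contraction_def
    by (rule ops_compose[OF ops_cadj[OF VE VF U_ops(1)]
          ops_compose[OF edge_contraction(1)[OF F] U_ops(2)]])
  moreover have "?rhs \<in> ops (range_space m E w) (range_space m E (w @ [j]))"
    by (rule ops_compose[OF X_inv_root(1)[OF E X sp w]
          ops_compose[OF edge_contraction(1)[OF E] X_root(1)[OF E X sp wj]]])
  moreover have "?lhs (?S h) = ?rhs (?S h)" for h
  proof -
    have "cadj ?U (?S h) = povm_root m F w h"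
      using unitary_cadj_cancel[OF VF VE U(1) povm_root_in_range_space] by (simp add: U(2))
    then have "?lhs (?S h) = factor_map m E X (w @ [j]) h"
      by (simp add: coord_edge_contraction_def edge_contraction(3)[OF F] U'(2))
    also have "\<dots> = ?rhs (?S h)"
      by (simp add: factor_map_def X_inv_root(2)[OF E X sp w povm_root_in_range_space]
          edge_contraction(3)[OF E])
    finally show ?thesis .
  qed
  ultimately show ?thesis
    using ops_closure_range_eqI[OF S] unfolding closure_range_factor_map[OF E X sp w] by blast
qed

text \<open>The coordinate unitaries preserve the relation \<open>A = C\<^sup>*C\<close> between splitting operators and
  edge contractions.\<close>

lemma coord_splitting_op_eq:
  assumes E: "povm m E" and X: "range_martingale m E X" and sp: "strictly_positive m E X"
    and F: "povm m F"
    and F_cyl: "\<And>w. w \<in> words m \<Longrightarrow> F (cyl m w) = povm_root m E w o\<^sub>L X w o\<^sub>L povm_root m E w"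
    and w: "w \<in> words m" and wj: "w @ [j] \<in> words m"
  shows "coord_splitting_op m E X F w j =
    cadj (coord_edge_contraction m E X F w j) o\<^sub>L coord_edge_contraction m E X F w j"
proof -
  define U U' C where "U = factor_unitary m E X F w" and "U' = factor_unitary m E X F (w @ [j])"
    and "C = edge_contraction m F w j"
  note VE = closed_csubspace_range_space[OF E] and VF = closed_csubspace_range_space[OF F]
  have U: "unitary_between (range_space m F w) (range_space m E w) U"
    "unitary_between (range_space m F (w @ [j])) (range_space m E (w @ [j])) U'"
    using factor_unitary(1)[OF E X sp F F_cyl[OF w] w]
      factor_unitary(1)[OF E X sp F F_cyl[OF wj] wj] by (simp_all add: U_def U'_def)
  have C: "C \<in> ops (range_space m F w) (range_space m F (w @ [j]))"
    unfolding C_def by (rule edge_contraction(1)[OF F])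
  have lin: "clinear_op U" "clinear_op U'" "clinear_op C"
    using U C by (auto simp: unitary_between_def ops_def)
  have adj: "cadj (U' o\<^sub>L C o\<^sub>L cadj U) = U o\<^sub>L (cadj C o\<^sub>L cadj U')"
    by (simp add: cadj_compose cadj_cadj clinear_op_compose clinear_op_cadj lin)
  have "cadj U' (U' (C x)) = C x" for x
    by (rule unitary_cadj_cancel[OF VF VE U(2) opsD(3)[OF C]])
  then have "U o\<^sub>L (cadj C o\<^sub>L C) o\<^sub>L cadj U
      = cadj (U' o\<^sub>L C o\<^sub>L cadj U) o\<^sub>L (U' o\<^sub>L C o\<^sub>L cadj U)"
    unfolding adj by (intro blinfun_eqI) simp
  then show ?thesis
    unfolding coord_splitting_op_def coord_edge_contraction_def splitting_op_eq[OF F]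
      U_def U'_def C_def .
qed

theorem theorem6p3:
  fixes m :: nat
    and E E_X :: "(nat \<Rightarrow> nat) set \<Rightarrow> ('h::chilbert_space \<Rightarrow>\<^sub>L 'h)"
    and X :: "nat list \<Rightarrow> ('h \<Rightarrow>\<^sub>L 'h)"
  assumes "m \<ge> 2"
    and "povm m E"
    and "range_martingale m E X"
    and "strictly_positive m E X"
    and "normalized X"
    and "povm m E_X"
    and "\<forall>w\<in>words m. E_X (cyl m w) = povm_root m E w o\<^sub>L X w o\<^sub>L povm_root m E w"
  shows "\<forall>w\<in>words m. \<forall>j<m.
      coord_edge_contraction m E X E_X w j =
        X_root m E X (w @ [j]) o\<^sub>L edge_contraction m E w j o\<^sub>L X_inv_root m E X w \<and>
      coord_splitting_op m E X E_X w j =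
        X_inv_root m E X w o\<^sub>L cadj (edge_contraction m E w j) o\<^sub>L X (w @ [j])
          o\<^sub>L edge_contraction m E w j o\<^sub>L X_inv_root m E X w"
proof (intro ballI allI impI)
  fix w j assume w: "w \<in> words m" and "j < m"
  note E = assms(2) and X = assms(3) and sp = assms(4) and F = assms(6)
  have wj: "w @ [j] \<in> words m"
    using w \<open>j < m\<close> by (simp add: words_def)
  have F_cyl: "E_X (cyl m v) = povm_root m E v o\<^sub>L X v o\<^sub>L povm_root m E v" if "v \<in> words m" for v
    using assms(7) that by blast
  define R C Q where "R = X_root m E X (w @ [j])" and "C = edge_contraction m E w j"
    and "Q = X_inv_root m E X w"
  have edge: "coord_edge_contraction m E X E_X w j = R o\<^sub>L C o\<^sub>L Q"
    unfolding R_def C_def Q_def by (rule coord_edge_contraction_eq[OF E X sp F F_cyl w wj])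
  have R: "positive_op R" "R o\<^sub>L R = X (w @ [j])"
    using X_root[OF E X sp wj] by (simp_all add: R_def)
  have lin: "clinear_op R" "clinear_op C" "clinear_op Q"
    using positive_opD(1)[OF R(1)] opsD(1)[OF edge_contraction(1)[OF E, of w j]]
      opsD(1)[OF X_inv_root(1)[OF E X sp w]] by (simp_all add: C_def Q_def)
  have "cadj R = R"
    by (rule cadj_eqI[OF lin(1) positive_opD(2)[OF R(1)]])
  moreover have "cadj Q = Q"
    unfolding Q_def by (rule X_inv_root(4)[OF E X sp w])
  ultimately have adj: "cadj (R o\<^sub>L C o\<^sub>L Q) = Q o\<^sub>L (cadj C o\<^sub>L R)"
    by (simp add: cadj_compose clinear_op_compose lin)
  have "coord_splitting_op m E X E_X w j = cadj (R o\<^sub>L C o\<^sub>L Q) o\<^sub>L (R o\<^sub>L C o\<^sub>L Q)"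
    using coord_splitting_op_eq[OF E X sp F F_cyl w wj] by (simp only: edge)
  also have "\<dots> = Q o\<^sub>L cadj C o\<^sub>L X (w @ [j]) o\<^sub>L C o\<^sub>L Q"
    unfolding adj R(2)[symmetric] by (rule blinfun_eqI) simp
  finally show "coord_edge_contraction m E X E_X w j =
        X_root m E X (w @ [j]) o\<^sub>L edge_contraction m E w j o\<^sub>L X_inv_root m E X w \<and>
      coord_splitting_op m E X E_X w j =
        X_inv_root m E X w o\<^sub>L cadj (edge_contraction m E w j) o\<^sub>L X (w @ [j])
          o\<^sub>L edge_contraction m E w j o\<^sub>L X_inv_root m E X w"
    using edge unfolding R_def C_def Q_def by blast
qed

end
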